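(* Each of the sets $RC$, $LC$, $RW$, $LW$ (of right-infinite products of non-degenerate curls, left-infinite products of non-degenerate curls, right-infinite products of non-degenerate whirls, and left-infinite products of non-degenerate whirls, respectively) forms a semigroup under matrix multiplication.
   Context: Fix $n\ge1$. All matrices are doubly infinite real matrices $X=(x_{i,j})_{i,j\in\mathbb{Z}}$ with $x_{i+n,j+n}=x_{i,j}$, upper triangular with $1$'s on the diagonal. The whirl $M(a_1,\dots,a_n)$ has $m_{i,i}=1$, $m_{i,i+1}=a_i$ (index modulo $n$), other entries $0$. The curl $N(a_1,\dots,a_n)$ has $1$'s on the diagonal, $(i,j)$ entry $a_ia_{i+1}\cdots a_{j-1}$ for $i<j$ (indices modulo $n$), and $0$ below the diagonal. A whirl or curl is non-degenerate if all its parameters $a_1,\dots,a_n$ are strictly positive. Limits of matrices are entrywise; $\prod_{i=1}^\infty X^{(i)}=\lim_{k\to\infty}X^{(1)}\cdots X^{(k)}$ and $\prod_{i=-\infty}^{-1}X^{(i)}=\lim_{k\to-\infty}X^{(k)}X^{(k+1)}\cdots X^{(-1)}$. $RC$ (resp. $RW$) is the set of all matrices $\prod_{i=1}^\infty N(a^{(i)}_1,\dots,a^{(i)}_n)$ (resp. $\prod_{i=1}^\infty M(a^{(i)}_1,\dots,a^{(i)}_n)$) with all $a^{(i)}_j>0$ and $\sum_{i,j}a^{(i)}_j<\infty$. $LC$ (resp. $LW$) is the set of all matrices $\prod_{i=-\infty}^{-1} N(a^{(i)}_1,\dots,a^{(i)}_n)$ (resp. $\prod_{i=-\infty}^{-1}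 M(a^{(i)}_1,\dots,a^{(i)}_n)$) with all $a^{(i)}_j>0$ and $\sum_{i,j}a^{(i)}_j<\infty$. *)

theory Defs
  imports "HOL-Analysis.Analysis"
begin

type_synonym zmat = "int \<Rightarrow> int \<Rightarrow> real"

definition periodic_unitriangular :: "nat \<Rightarrow> zmat \<Rightarrow> bool" where
  "periodic_unitriangular n X \<longleftrightarrow>
     (\<forall>i j. X (i + int n) (j + int n) = X i j) \<and>
     (\<forall>i. X i i = 1) \<and>
     (\<forall>i j. j < i \<longrightarrow> X i j = 0)"

text \<open>The sum over all of \<open>\<int>\<close> has finite support whenever both factors are upper triangular;
  see \<open>mat_mult_upper\<close> below.\<close>

definition mat_mult :: "zmat \<Rightarrow> zmat \<Rightarrow> zmat" where
  "mat_mult X Y = (\<lambda>i j. \<Sum>\<^sub>\<infinity>k. X i k * Y k j)"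

definition mat_one :: zmat where
  "mat_one = (\<lambda>i j. if i = j then 1 else 0)"

text \<open>The representative of \<open>i\<close> modulo \<open>n\<close> in \<open>{1..n}\<close>. A parameter tuple
  \<open>(a\<^sub>1, \<dots>, a\<^sub>n)\<close> is a function on \<open>int\<close> of which only the values on \<open>{1..n}\<close> are used.\<close>

definition cyc :: "nat \<Rightarrow> int \<Rightarrow> int" where
  "cyc n i = (i - 1) mod int n + 1"

definition whirl :: "nat \<Rightarrow> (int \<Rightarrow> real) \<Rightarrow> zmat" where
  "whirl n a = (\<lambda>i j. if j = i then 1 else if j = i + 1 then a (cyc n i) else 0)"

definition curl :: "nat \<Rightarrow> (int \<Rightarrow> real) \<Rightarrow> zmat" where
  "curl n a = (\<lambda>i j. if i = j then 1 else if i < j then \<Prod>k\<in>{i..<j}. a (cyc n k) else 0)"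

definition nondegenerate :: "nat \<Rightarrow> (int \<Rightarrow> real) \<Rightarrow> bool" where
  "nondegenerate n a \<longleftrightarrow> (\<forall>j\<in>{1..int n}. a j > 0)"

text \<open>The ordered product \<open>X\<^sup>(\<^sup>k\<^sup>) X\<^sup>(\<^sup>k\<^sup>+\<^sup>1\<^sup>) \<cdots> X\<^sup>(\<^sup>l\<^sup>)\<close>, the identity if \<open>l < k\<close>.\<close>

definition mat_prod :: "(int \<Rightarrow> zmat) \<Rightarrow> int \<Rightarrow> int \<Rightarrow> zmat" where
  "mat_prod X k l = foldr mat_mult (map X [k..l]) mat_one"

definition entrywise_limit :: "(int \<Rightarrow> zmat) \<Rightarrow> zmat \<Rightarrow> int filter \<Rightarrow> bool" where
  "entrywise_limit F L G \<longleftrightarrow> (\<forall>i j. ((\<lambda>k. F k i j) \<longlongrightarrow> L i j) G)"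

definition is_right_inf_prod :: "(int \<Rightarrow> zmat) \<Rightarrow> zmat \<Rightarrow> bool" where
  "is_right_inf_prod X P \<longleftrightarrow> entrywise_limit (\<lambda>k. mat_prod X 1 k) P at_top"

definition is_left_inf_prod :: "(int \<Rightarrow> zmat) \<Rightarrow> zmat \<Rightarrow> bool" where
  "is_left_inf_prod X P \<longleftrightarrow> entrywise_limit (\<lambda>k. mat_prod X k (-1)) P at_bot"

text \<open>The parameter \<open>a\<^sub>j\<^sup>(\<^sup>i\<^sup>)\<close> is \<open>a i j\<close>, for \<open>i\<close> in the index set \<open>I\<close> and \<open>j\<close> in \<open>{1..n}\<close>.\<close>

definition admissible :: "nat \<Rightarrow> int set \<Rightarrow> (int \<Rightarrow> int \<Rightarrow> real) \<Rightarrow> bool" where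
  "admissible n I a \<longleftrightarrow>
     (\<forall>i\<in>I. nondegenerate n (a i)) \<and> (\<lambda>(i, j). a i j) summable_on (I \<times> {1..int n})"

definition RC :: "nat \<Rightarrow> zmat set" where
  "RC n = {P. \<exists>a. admissible n {1..} a \<and> is_right_inf_prod (\<lambda>i. curl n (a i)) P}"

definition RW :: "nat \<Rightarrow> zmat set" where
  "RW n = {P. \<exists>a. admissible n {1..} a \<and> is_right_inf_prod (\<lambda>i. whirl n (a i)) P}"

definition LC :: "nat \<Rightarrow> zmat set" where
  "LC n = {P. \<exists>a. admissible n {..-1} a \<and> is_left_inf_prod (\<lambda>i. curl n (a i)) P}"

definition LW :: "nat \<Rightarrow> zmat set" where
  "LW n = {P. \<exists>a. admissible n {..-1} a \<and> is_left_inf_prod (\<lambda>i. whirl n (a i)) P}"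

definition semigroup_on :: "'a set \<Rightarrow> ('a \<Rightarrow> 'a \<Rightarrow> 'a) \<Rightarrow> bool" where
  "semigroup_on S f \<longleftrightarrow>
     (\<forall>x\<in>S. \<forall>y\<in>S. f x y \<in> S) \<and>
     (\<forall>x\<in>S. \<forall>y\<in>S. \<forall>z\<in>S. f (f x y) z = f x (f y z))"

lemma mat_mult_upper:
  assumes "\<And>i j. j < i \<Longrightarrow> X i j = 0" and "\<And>i j. j < i \<Longrightarrow> Y i j = 0"
  shows "mat_mult X Y i j = (\<Sum>k=i..j. X i k * Y k j)"
proof -
  have "mat_mult X Y i j = (\<Sum>\<^sub>\<infinity>k\<in>{i..j}. X i k * Y k j)"
    unfolding mat_mult_def by (rule infsum_cong_neutral) (use assms in \<open>auto simp: not_le\<close>)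
  then show ?thesis by simp
qed

lemma cyc_periodic: "cyc n (i + int n) = cyc n i"
proof -
  have "i + int n - 1 = (i - 1) + int n" by simp
  then show ?thesis by (simp only: cyc_def mod_add_self2)
qed

lemma periodic_unitriangular_whirl: "periodic_unitriangular n (whirl n a)"
  by (simp add: periodic_unitriangular_def whirl_def cyc_periodic)

lemma periodic_unitriangular_curl: "periodic_unitriangular n (curl n a)"
proof -
  have cyc_shift: "cyc n (k - int n) = cyc n k" for k
    using cyc_periodic[of n "k - int n"] by simp
  have "(\<Prod>k\<in>{i + int n..<j + int n}. a (cyc n k)) = (\<Prod>k\<in>{i..<j}. a (cyc n k))" for i j
    by (rule prod.reindex_bij_witness[of _ "\<lambda>k. k + int n" "\<lambda>k. k - int n"])
      (auto simp: cyc_shift)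
  then show ?thesis
    by (simp add: periodic_unitriangular_def curl_def)
qed

lemma periodic_unitriangular_mult:
  assumes "periodic_unitriangular n X" and "periodic_unitriangular n Y"
  shows "periodic_unitriangular n (mat_mult X Y)"
proof -
  have m: "mat_mult X Y i j = (\<Sum>k=i..j. X i k * Y k j)" for i j
    using assms by (intro mat_mult_upper) (auto simp: periodic_unitriangular_def)
  have "(\<Sum>k=i + int n..j + int n. X (i + int n) k * Y k (j + int n))
      = (\<Sum>k=i..j. X i k * Y k j)" for i j
  proof (rule sum.reindex_bij_witness[of _ "\<lambda>k. k + int n" "\<lambda>k. k - int n"])
    fix k
    have "X (i + int n) ((k - int n) + int n) = X i (k - int n)"
      and "Y ((k - int n) + int n) (j + int n) = Y (k - int n) j"
      using assms unfolding periodic_unitriangular_def by blast+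
    then show "X i (k - int n) * Y (k - int n) j = X (i + int n) k * Y k (j + int n)"
      by simp
  qed auto
  then show ?thesis
    using assms by (simp add: periodic_unitriangular_def m)
qed

end

theory Submission
  imports Defs
begin

text \<open>The four sets are handled at once. A whirl or curl is a matrix \<open>E p\<close> depending on a positive
\<open>n\<close>-periodic parameter sequence \<open>p\<close>, and all that matters about such a family is that two factors can be
commuted: \<open>E a E b = E b' E a'\<close> with \<open>b'\<close>, \<open>a'\<close> again positive and periodic. For whirls this is the
birational map built from the cyclic sums \<open>kappa\<close>; for curls it follows by inverting, because the curl of
\<open>a\<close> is the inverse of the whirl of \<open>- a\<close>. The locale \<open>factor_family\<close> collects these facts together with one
estimate: as long as \<open>b\<close> stays in a compact subset of the positive reals, \<open>a'\<close> is at most a constant times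
\<open>a\<close>.

The heart of the proof is that a right-infinite product times one further factor, \<open>A\<^sub>0 A\<^sub>1 \<cdots> B\<close>, is again a
right-infinite product. If the total mass of the \<open>A\<^sub>k\<close> is small, moving \<open>B\<close> to the left through
\<open>A\<^sub>m\<close>, ..., \<open>A\<^sub>0\<close> perturbs it so little that it stays bounded and bounded away from zero, uniformly in \<open>m\<close>.
A diagonal subsequence therefore gives positive parameters \<open>B\<^sub>k\<close> with
\<open>A\<^sub>k B\<^sub>k\<^sub>+\<^sub>1 = B\<^sub>k A'\<^sub>k\<close> for all \<open>k\<close> and \<open>B\<^sub>k\<close> tending to \<open>B\<close>, and the product equals \<open>B\<^sub>0 A'\<^sub>0 A'\<^sub>1 \<cdots>\<close>, where the
masses of the \<open>A'\<^sub>k\<close> are again summable (\<open>right_products_mult_small\<close>). In general only a tail of the product has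
small mass, and the finitely many factors in front of it can be put back afterwards
(\<open>right_products_mult_factor\<close>).

For a product of \<open>P\<close> and \<open>Q = B\<^sub>0 B\<^sub>1 \<cdots>\<close>, the factors \<open>B\<^sub>j\<close> are absorbed one at a time: starting with
\<open>T\<^sub>0 = P\<close>, the matrix \<open>T\<^sub>j B\<^sub>j\<close> is a right-infinite product, and it is split as \<open>F\<^sub>j T\<^sub>j\<^sub>+\<^sub>1\<close> with \<open>F\<^sub>j\<close> a finite
product long enough that the mass of \<open>T\<^sub>j\<^sub>+\<^sub>1\<close> is at most \<open>1 / (j + 1)\<close>. Then
\<open>F\<^sub>0 \<cdots> F\<^sub>j\<^sub>-\<^sub>1 T\<^sub>j = P B\<^sub>0 \<cdots> B\<^sub>j\<^sub>-\<^sub>1\<close>, and \<open>T\<^sub>j\<close> tends to the identity, so \<open>F\<^sub>0 F\<^sub>1 \<cdots> = P Q\<close>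
(\<open>right_products_mult_closed\<close>).

Left-infinite products reduce to right-infinite ones by the anti-automorphism sending \<open>X\<close> to the matrix with
entries \<open>X (- j) (- i)\<close>, which maps whirls to whirls and curls to curls.\<close>

section \<open>Unitriangular matrices and their products\<close>

definition unitriangular :: "zmat \<Rightarrow> bool" where
  "unitriangular X \<longleftrightarrow> (\<forall>i. X i i = 1) \<and> (\<forall>i j. j < i \<longrightarrow> X i j = 0)"

lemma unitriangularD:
  assumes "unitriangular X"
  shows "X i i = 1" and "j < i \<Longrightarrow> X i j = 0"
  using assms by (auto simp: unitriangular_def)

lemma unitriangular_mat_one: "unitriangular mat_one"
  by (simp add: unitriangular_def mat_one_def)

lemma mat_mult_eq_sum:
  assumes "unitriangular X" "unitriangular Y"
  shows "mat_mult X Y i j = (\<Sum>k=i..j. X i k * Y k j)"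
  using assms by (intro mat_mult_upper) (auto simp: unitriangular_def)

lemma unitriangular_mat_mult:
  assumes "unitriangular X" "unitriangular Y"
  shows "unitriangular (mat_mult X Y)"
  using assms by (simp add: unitriangular_def mat_mult_eq_sum)

lemma mat_mult_assoc:
  assumes X: "unitriangular X" and Y: "unitriangular Y" and Z: "unitriangular Z"
  shows "mat_mult (mat_mult X Y) Z = mat_mult X (mat_mult Y Z)"
proof (intro ext)
  fix i j
  have "mat_mult (mat_mult X Y) Z i j = (\<Sum>k=i..j. (\<Sum>l=i..k. X i l * Y l k) * Z k j)"
    using X Y Z by (simp add: mat_mult_eq_sum unitriangular_mat_mult)
  also have "\<dots> = (\<Sum>k=i..j. \<Sum>l=i..j. X i l * Y l k * Z k j)"
    unfolding sum_distrib_right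
    by (rule sum.cong[OF refl], rule sum.mono_neutral_left) (auto simp: unitriangularD(2)[OF Y])
  also have "\<dots> = (\<Sum>l=i..j. \<Sum>k=i..j. X i l * Y l k * Z k j)"
    by (rule sum.swap)
  also have "\<dots> = (\<Sum>l=i..j. \<Sum>k=l..j. X i l * Y l k * Z k j)"
    by (rule sum.cong[OF refl], rule sum.mono_neutral_right) (auto simp: unitriangularD(2)[OF Y])
  also have "\<dots> = mat_mult X (mat_mult Y Z) i j"
    using X Y Z by (simp add: mat_mult_eq_sum unitriangular_mat_mult sum_distrib_left mult.assoc)
  finally show "mat_mult (mat_mult X Y) Z i j = mat_mult X (mat_mult Y Z) i j" .
qed

lemma mat_mult_one_right:
  assumes "unitriangular X"
  shows "mat_mult X mat_one = X"
proof (intro ext)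
  fix i j
  have "mat_mult X mat_one i j = (\<Sum>k=i..j. if k = j then X i k else 0)"
    unfolding mat_mult_eq_sum[OF assms unitriangular_mat_one]
    by (rule sum.cong) (auto simp: mat_one_def)
  then show "mat_mult X mat_one i j = X i j"
    using unitriangularD(2)[OF assms, of j i] by (simp add: not_le)
qed

lemma mat_mult_one_left:
  assumes "unitriangular X"
  shows "mat_mult mat_one X = X"
proof (intro ext)
  fix i j
  have "mat_mult mat_one X i j = (\<Sum>k=i..j. if k = i then X k j else 0)"
    unfolding mat_mult_eq_sum[OF unitriangular_mat_one assms]
    by (rule sum.cong) (auto simp: mat_one_def)
  then show "mat_mult mat_one X i j = X i j"
    using unitriangularD(2)[OF assms, of j i] by (simp add: not_le)
qed

lemma mat_mult_superdiagonal:
  assumes "unitriangular X" "unitriangular Y"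
  shows "mat_mult X Y i (i + 1) = X i (i + 1) + Y i (i + 1)"
proof -
  have "{i..i + 1} = {i, i + 1}" by auto
  then show ?thesis
    using assms by (simp add: mat_mult_eq_sum unitriangularD)
qed

definition mat_lim :: "(nat \<Rightarrow> zmat) \<Rightarrow> zmat \<Rightarrow> bool" where
  "mat_lim F L \<longleftrightarrow> (\<forall>i j. (\<lambda>m. F m i j) \<longlonglongrightarrow> L i j)"

lemma mat_lim_unique: "mat_lim F L \<Longrightarrow> mat_lim F L' \<Longrightarrow> L = L'"
  by (intro ext) (metis mat_lim_def LIMSEQ_unique)

lemma mat_lim_const: "mat_lim (\<lambda>m. X) X"
  by (simp add: mat_lim_def)

lemma mat_lim_subseq: "mat_lim F L \<Longrightarrow> strict_mono r \<Longrightarrow> mat_lim (\<lambda>m. F (r m)) L"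
  unfolding mat_lim_def using LIMSEQ_subseq_LIMSEQ[unfolded o_def] by fast

lemma unitriangular_mat_lim:
  assumes "mat_lim F L" "\<And>m. unitriangular (F m)"
  shows "unitriangular L"
proof -
  have lim: "(\<lambda>m. F m i j) \<longlonglongrightarrow> L i j" for i j using assms(1) by (simp add: mat_lim_def)
  have "(\<lambda>m. F m i i) = (\<lambda>_. 1)" "j < i \<Longrightarrow> (\<lambda>m. F m i j) = (\<lambda>_. 0)" for i j
    using unitriangularD[OF assms(2)] by auto
  then show ?thesis
    unfolding unitriangular_def
    using lim by (metis LIMSEQ_const_iff)
qed

lemma mat_lim_mat_mult:
  assumes F: "mat_lim F L" and G: "mat_lim G M"
    and uF: "\<And>m. unitriangular (F m)" and uG: "\<And>m. unitriangular (G m)"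
  shows "mat_lim (\<lambda>m. mat_mult (F m) (G m)) (mat_mult L M)"
  using F G unitriangular_mat_lim[OF F uF] unitriangular_mat_lim[OF G uG]
  by (auto simp: mat_lim_def mat_mult_eq_sum uF uG intro!: tendsto_sum tendsto_mult)

definition prod_mats :: "zmat list \<Rightarrow> zmat" where
  "prod_mats Xs = foldr mat_mult Xs mat_one"

lemma prod_mats_simps [simp]:
  "prod_mats [] = mat_one" "prod_mats (X # Xs) = mat_mult X (prod_mats Xs)"
  by (simp_all add: prod_mats_def)

lemma unitriangular_prod_mats:
  "(\<And>X. X \<in> set Xs \<Longrightarrow> unitriangular X) \<Longrightarrow> unitriangular (prod_mats Xs)"
  by (induction Xs) (simp_all add: unitriangular_mat_one unitriangular_mat_mult)

lemma prod_mats_append: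
  assumes "\<And>X. X \<in> set (Xs @ Ys) \<Longrightarrow> unitriangular X"
  shows "prod_mats (Xs @ Ys) = mat_mult (prod_mats Xs) (prod_mats Ys)"
  using assms
  by (induction Xs) (simp_all add: mat_mult_one_left mat_mult_assoc unitriangular_prod_mats)

text \<open>Reflection in the antidiagonal. Unlike the transpose it preserves upper triangularity, and like the transpose it reverses the order of products.\<close>

definition mat_reverse :: "zmat \<Rightarrow> zmat" where
  "mat_reverse X = (\<lambda>i j. X (- j) (- i))"

lemma mat_reverse_reverse [simp]: "mat_reverse (mat_reverse X) = X"
  by (simp add: mat_reverse_def)

lemma unitriangular_mat_reverse: "unitriangular X \<Longrightarrow> unitriangular (mat_reverse X)"
  by (simp add: unitriangular_def mat_reverse_def)

lemma mat_reverse_one: "mat_reverse mat_one = mat_one"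
  by (simp add: mat_reverse_def mat_one_def fun_eq_iff eq_commute)

lemma mat_reverse_mult:
  assumes "unitriangular X" "unitriangular Y"
  shows "mat_reverse (mat_mult X Y) = mat_mult (mat_reverse Y) (mat_reverse X)"
proof (intro ext)
  fix i j
  have "mat_reverse (mat_mult X Y) i j = (\<Sum>k=-j..-i. X (-j) k * Y k (-i))"
    using assms by (simp add: mat_reverse_def mat_mult_eq_sum)
  also have "\<dots> = (\<Sum>k=i..j. mat_reverse Y i k * mat_reverse X k j)"
    by (rule sum.reindex_bij_witness[of _ uminus uminus]) (auto simp: mat_reverse_def)
  also have "\<dots> = mat_mult (mat_reverse Y) (mat_reverse X) i j"
    using assms by (simp add: mat_mult_eq_sum unitriangular_mat_reverse)
  finally show "mat_reverse (mat_mult X Y) i j = mat_mult (mat_reverse Y) (mat_reverse X) i j" .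
qed

lemma mat_reverse_prod_mats:
  assumes "\<And>X. X \<in> set Xs \<Longrightarrow> unitriangular X"
  shows "mat_reverse (prod_mats Xs) = prod_mats (rev (map mat_reverse Xs))"
  using assms
proof (induction Xs)
  case (Cons X Xs)
  then have "mat_reverse (prod_mats (X # Xs))
      = mat_mult (prod_mats (rev (map mat_reverse Xs))) (mat_reverse X)"
    by (simp add: mat_reverse_mult unitriangular_prod_mats)
  also have "\<dots> = prod_mats (rev (map mat_reverse Xs) @ [mat_reverse X])"
    using Cons.prems
    by (subst prod_mats_append) (auto simp: unitriangular_mat_reverse mat_mult_one_right)
  finally show ?case by simp
qed (simp add: mat_reverse_one)

lemma mat_lim_reverse: "mat_lim F P \<Longrightarrow> mat_lim (\<lambda>m. mat_reverse (F m)) (mat_reverse P)"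
  by (simp add: mat_lim_def mat_reverse_def)

section \<open>Entrywise bounds that add up under multiplication\<close>

text \<open>A bound by powers of \<open>s\<close> along the diagonals: it holds for a whirl or curl whose parameters are at most \<open>s\<close>,
and under multiplication the constants \<open>s\<close> simply add. So summable parameters give entrywise bounded products,
and products whose total mass tends to zero tend to the identity.\<close>

definition dominated :: "real \<Rightarrow> zmat \<Rightarrow> bool" where
  "dominated s X \<longleftrightarrow> (\<forall>i j. 0 \<le> X i j \<and> (i \<le> j \<longrightarrow> X i j \<le> s ^ nat (j - i)))"

lemma dominatedD:
  assumes "dominated s X"
  shows "0 \<le> X i j" and "i \<le> j \<Longrightarrow> X i j \<le> s ^ nat (j - i)"
  using assms by (auto simp: dominated_def)

lemma dominated_mat_one: "0 \<le> s \<Longrightarrow> dominated s mat_one"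
  by (auto simp: dominated_def mat_one_def)

lemma dominated_mono: "dominated s X \<Longrightarrow> 0 \<le> s \<Longrightarrow> s \<le> t \<Longrightarrow> dominated t X"
  unfolding dominated_def by (meson order_trans power_mono)

text \<open>The left-hand side is the binomial expansion with all binomial coefficients replaced by \<open>1\<close>.\<close>

lemma sum_power_mult_le_power_add:
  fixes s t :: real
  assumes "0 \<le> s" "0 \<le> t"
  shows "(\<Sum>k\<le>d. s ^ k * t ^ (d - k)) \<le> (s + t) ^ d"
  unfolding binomial_ring
proof (rule sum_mono)
  fix k assume "k \<in> {..d}"
  then have "1 \<le> real (d choose k)"
    by (simp add: Suc_leI)
  then have "1 * (s ^ k * t ^ (d - k)) \<le> real (d choose k) * (s ^ k * t ^ (d - k))"
    using assms by (intro mult_right_mono) auto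
  then show "s ^ k * t ^ (d - k) \<le> real (d choose k) * s ^ k * t ^ (d - k)"
    by (simp add: mult.assoc)
qed

lemma dominated_mat_mult:
  assumes uX: "unitriangular X" and uY: "unitriangular Y"
    and X: "dominated s X" and Y: "dominated t Y" and "0 \<le> s" "0 \<le> t"
  shows "dominated (s + t) (mat_mult X Y)"
  unfolding dominated_def
proof (intro allI conjI impI)
  fix i j :: int
  show "0 \<le> mat_mult X Y i j"
    unfolding mat_mult_eq_sum[OF uX uY] using X Y by (intro sum_nonneg mult_nonneg_nonneg) (auto dest: dominatedD)
  assume "i \<le> j"
  have "mat_mult X Y i j \<le> (\<Sum>k=i..j. s ^ nat (k - i) * t ^ nat (j - k))"
    unfolding mat_mult_eq_sum[OF uX uY] using X Y assms(5,6)
    by (intro sum_mono mult_mono) (auto dest: dominatedD)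
  also have "\<dots> = (\<Sum>k\<le>nat (j - i). s ^ k * t ^ (nat (j - i) - k))"
    using \<open>i \<le> j\<close>
    by (intro sum.reindex_bij_witness[of _ "\<lambda>k. i + int k" "\<lambda>k. nat (k - i)"]) (auto simp: nat_diff_distrib' algebra_simps intro!: arg_cong2[where f="(*)"] arg_cong2[where f="power"])
  also have "\<dots> \<le> (s + t) ^ nat (j - i)"
    using assms(5,6) by (rule sum_power_mult_le_power_add)
  finally show "mat_mult X Y i j \<le> (s + t) ^ nat (j - i)" .
qed

text \<open>With \<open>1\<close> on the diagonal of \<open>Y\<close>, the entry of \<open>X\<close> is one of the nonnegative summands. This makes partial products increase entrywise.\<close>

lemma mat_mult_ge_left:
  assumes uX: "unitriangular X" and uY: "unitriangular Y"
    and X: "\<And>i j. 0 \<le> X i j" and Y: "\<And>i j. 0 \<le> Y i j"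
  shows "X i j \<le> mat_mult X Y i j"
proof (cases "i \<le> j")
  case True
  have "X i j * Y j j \<le> (\<Sum>k=i..j. X i k * Y k j)"
    by (rule member_le_sum) (use True X Y in auto)
  then show ?thesis by (simp add: mat_mult_eq_sum[OF uX uY] unitriangularD(1)[OF uY])
next
  case False
  then show ?thesis
    by (simp add: unitriangularD(2) uX unitriangular_mat_mult[OF uX uY])
qed

lemma dominated_mat_lim_one:
  assumes "\<And>m. dominated (s m) (F m)" "\<And>m. unitriangular (F m)" "s \<longlonglongrightarrow> 0"
  shows "mat_lim F mat_one"
  unfolding mat_lim_def
proof (intro allI)
  fix i j :: int
  consider "i = j" | "j < i" | "i < j" by linarith
  then show "(\<lambda>m. F m i j) \<longlonglongrightarrow> mat_one i j"
  proof cases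
    case 3
    have "(\<lambda>m. s m ^ nat (j - i)) \<longlonglongrightarrow> 0 ^ nat (j - i)"
      by (intro tendsto_power assms)
    then have "(\<lambda>m. s m ^ nat (j - i)) \<longlonglongrightarrow> 0"
      using 3 by (simp add: zero_power)
    then have "(\<lambda>m. F m i j) \<longlonglongrightarrow> 0"
      by (rule tendsto_sandwich[rotated 2, OF tendsto_const])
        (use 3 dominatedD[OF assms(1)] in auto)
    then show ?thesis using 3 by (simp add: mat_one_def)
  qed (use unitriangularD[OF assms(2)] in \<open>simp_all add: mat_one_def\<close>)
qed

section \<open>Positive periodic parameters\<close>

definition positive_param :: "nat \<Rightarrow> (int \<Rightarrow> real) \<Rightarrow> bool" where
  "positive_param n p \<longleftrightarrow> (\<forall>i. p (i + int n) = p i) \<and> (\<forall>i. 0 < p i)"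

text \<open>By periodicity the sum of the parameters over one period bounds each single parameter.\<close>

definition mass :: "nat \<Rightarrow> (int \<Rightarrow> real) \<Rightarrow> real" where
  "mass n p = (\<Sum>j=1..int n. p j)"

lemma periodic_add_mult:
  assumes "\<And>i::int. p (i + int n) = p i"
  shows "p (i + k * int n) = p i"
proof (induction k rule: int_induct[where k = 0])
  case (step1 k)
  then show ?case using assms[of "i + k * int n"] by (simp add: algebra_simps)
next
  case (step2 k)
  then show ?case using assms[of "i + (k - 1) * int n"] by (simp add: algebra_simps)
qed simp

lemma periodic_cyc:
  assumes "\<And>i::int. p (i + int n) = p i"
  shows "p (cyc n i) = p i"
proof -
  have "i - 1 = (i - 1) div int n * int n + (i - 1) mod int n" by simp
  then have "i = cyc n i + (i - 1) div int n * int n"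
    unfolding cyc_def by linarith
  then show ?thesis using periodic_add_mult[of p, OF assms] by metis
qed

lemma cyc_range: "1 \<le> n \<Longrightarrow> cyc n i \<in> {1..int n}"
  using pos_mod_bound[of "int n" "i - 1"] pos_mod_sign[of "int n" "i - 1"]
  unfolding cyc_def atLeastAtMost_iff by linarith

lemma cyc_cyc [simp]: "cyc n (cyc n i) = cyc n i"
  by (simp add: cyc_def)

lemma positive_paramD:
  assumes "positive_param n p"
  shows "p (i + int n) = p i" "0 < p i" "p (cyc n i) = p i"
  using assms periodic_cyc[of p n] by (auto simp: positive_param_def)

lemma positive_param_reverse:
  assumes "positive_param n p"
  shows "positive_param n (\<lambda>i. p (- 1 - i))"
  unfolding positive_param_def
proof (intro conjI allI)
  fix i
  show "p (- 1 - (i + int n)) = p (- 1 - i)"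
    using positive_paramD(1)[OF assms, of "- 1 - (i + int n)"] by (simp add: algebra_simps)
qed (rule positive_paramD(2)[OF assms])

lemma mass_nonneg: "positive_param n p \<Longrightarrow> 0 \<le> mass n p"
  unfolding mass_def by (intro sum_nonneg less_imp_le positive_paramD(2))

lemma le_mass:
  assumes "1 \<le> n" "positive_param n p"
  shows "p i \<le> mass n p"
proof -
  have "p (cyc n i) \<le> mass n p"
    unfolding mass_def using assms cyc_range
    by (intro member_le_sum) (auto intro: less_imp_le positive_paramD(2))
  then show ?thesis using positive_paramD(3)[OF assms(2)] by simp
qed

lemma positive_param_bounded_below:
  assumes "1 \<le> n" "positive_param n p"
  obtains d where "0 < d" "\<And>i. d \<le> p i"
proof
  show "0 < Min (p ` {1..int n})"
    using assms by (subst Min_gr_iff) (auto simp: positive_paramD)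
  show "Min (p ` {1..int n}) \<le> p i" for i
    using cyc_range[OF assms(1), of i] positive_paramD(3)[OF assms(2), of i]
    by (intro Min_le) (auto intro: rev_image_eqI)
qed

text \<open>A diagonal argument, carried out as sequential compactness of a countable power of a compact interval.\<close>

lemma bounded_array_convergent_subsequence:
  fixes f :: "nat \<Rightarrow> 'a::countable \<Rightarrow> 'b::countable \<Rightarrow> real"
  assumes "\<And>m k i. l \<le> f m k i" "\<And>m k i. f m k i \<le> u"
  obtains r g where "strict_mono (r :: nat \<Rightarrow> nat)" "\<And>k i. (\<lambda>m. f (r m) k i) \<longlonglongrightarrow> g k i"
proof -
  define S :: "('a \<times> 'b \<Rightarrow> real) set" where "S = Pi\<^sub>E UNIV (\<lambda>_. {l..u})"
  have "compactin (product_topology (\<lambda>_. euclidean) UNIV) S"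
    unfolding S_def by (subst compactin_PiE) (simp add: compactin_euclidean_iff)
  then have "compact S"
    by (simp add: euclidean_product_topology compactin_euclidean_iff)
  moreover have "(\<lambda>(k, i). f m k i) \<in> S" for m
    using assms by (auto simp: S_def)
  ultimately obtain h r where r: "strict_mono (r :: nat \<Rightarrow> nat)"
    and lim: "((\<lambda>m (k, i). f m k i) \<circ> r) \<longlonglongrightarrow> h"
    unfolding compact_eq_seq_compact_metric seq_compact_def by metis
  have "(\<lambda>m. f (r m) k i) \<longlonglongrightarrow> h (k, i)" for k i
  proof -
    have "continuous_on UNIV (\<lambda>x::'a \<times> 'b \<Rightarrow> real. x (k, i))"
      by (rule continuous_on_product_coordinates)
    then have "isCont (\<lambda>x::'a \<times> 'b \<Rightarrow> real. x (k, i)) h"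
      using continuous_on_eq_continuous_at open_UNIV by blast
    from isCont_tendsto_compose[OF this lim] show ?thesis by (simp add: o_def)
  qed
  then show ?thesis using that[of r "\<lambda>k i. h (k, i)"] r by simp
qed

section \<open>Families of matrices whose factors can be commuted\<close>

text \<open>The features shared by whirls and curls. In the exchange \<open>E a E b = E b' E a'\<close> the new left parameter \<open>b'\<close> is
\<open>pushL a b\<close> and the new right one \<open>a'\<close> is \<open>pushR a b\<close>. The last condition says that a small factor \<open>a\<close>
stays small when \<open>b\<close> passes through it, uniformly for \<open>b\<close> bounded and bounded away from zero. Continuity in
\<open>b\<close> serves the limiting argument, in which the factors \<open>a\<close> are fixed and only the moving factor varies.\<close>

locale factor_family =
  fixes n :: nat
    and E :: "(int \<Rightarrow> real) \<Rightarrow> zmat"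
    and pushL pushR :: "(int \<Rightarrow> real) \<Rightarrow> (int \<Rightarrow> real) \<Rightarrow> int \<Rightarrow> real"
  assumes n_pos: "1 \<le> n"
    and E_unitriangular: "unitriangular (E p)"
    and E_superdiagonal: "positive_param n p \<Longrightarrow> E p i (i + 1) = p i"
    and E_dominated: "positive_param n p \<Longrightarrow> (\<And>i. p i \<le> s) \<Longrightarrow> dominated s (E p)"
    and E_tendsto: "(\<And>i. (\<lambda>m. q m i) \<longlonglongrightarrow> p i) \<Longrightarrow> mat_lim (\<lambda>m. E (q m)) (E p)"
    and E_cyc: "E (\<lambda>i. p (cyc n i)) = E p"
    and E_reverse: "positive_param n p \<Longrightarrow> mat_reverse (E p) = E (\<lambda>i. p (- 1 - i))"
    and push_param: "positive_param n a \<Longrightarrow> positive_param n b \<Longrightarrow>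
          positive_param n (pushL a b) \<and> positive_param n (pushR a b)"
    and push_eq: "positive_param n a \<Longrightarrow> positive_param n b \<Longrightarrow>
          mat_mult (E a) (E b) = mat_mult (E (pushL a b)) (E (pushR a b))"
    and pushL_tendsto: "positive_param n a \<Longrightarrow> positive_param n b \<Longrightarrow>
          (\<And>i. (\<lambda>m. q m i) \<longlonglongrightarrow> b i) \<Longrightarrow> (\<lambda>m. pushL a (q m) i) \<longlonglongrightarrow> pushL a b i"
    and pushR_le: "positive_param n a \<Longrightarrow> positive_param n b \<Longrightarrow>
          0 < d \<Longrightarrow> (\<And>i. d \<le> b i) \<Longrightarrow> (\<And>i. b i \<le> D) \<Longrightarrow> (\<And>i. a i \<le> D) \<Longrightarrow> (\<And>i. a i \<le> s) \<Longrightarrow>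
          pushR a b i \<le> real n * (D / d) ^ (n - 1) * s"
begin

text \<open>The entries next to the diagonal add under multiplication, so exchanging two factors preserves the sum of the parameters.\<close>

lemma push_sum:
  assumes "positive_param n a" "positive_param n b"
  shows "a i + b i = pushL a b i + pushR a b i"
proof -
  have "mat_mult (E a) (E b) i (i + 1) = mat_mult (E (pushL a b)) (E (pushR a b)) i (i + 1)"
    by (simp add: push_eq assms)
  then show ?thesis
    using assms push_param[OF assms] by (simp add: mat_mult_superdiagonal E_unitriangular E_superdiagonal)
qed

text \<open>Summability is required separately at each position. This is equivalent to summability of the masses, and it does not change when the parameters are re-indexed by the reversal.\<close>

definition valid_seq :: "(nat \<Rightarrow> int \<Rightarrow> real) \<Rightarrow> bool" where
  "valid_seq A \<longleftrightarrow> (\<forall>k. positive_param n (A k)) \<and> (\<forall>i. summable (\<lambda>k. A k i))"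

definition partial_prod :: "(nat \<Rightarrow> int \<Rightarrow> real) \<Rightarrow> nat \<Rightarrow> zmat" where
  "partial_prod A m = prod_mats (map (\<lambda>k. E (A k)) [0..<m])"

definition right_products :: "zmat set" where
  "right_products = {P. \<exists>A. valid_seq A \<and> mat_lim (partial_prod A) P}"

lemma right_productsI: "valid_seq A \<Longrightarrow> mat_lim (partial_prod A) P \<Longrightarrow> P \<in> right_products"
  by (auto simp: right_products_def)

lemma unitriangular_prod_E: "unitriangular (prod_mats (map E ps))"
  by (rule unitriangular_prod_mats) (auto simp: E_unitriangular)

lemma prod_E_append:
  "prod_mats (map E (ps @ qs)) = mat_mult (prod_mats (map E ps)) (prod_mats (map E qs))"
  unfolding map_append by (rule prod_mats_append) (auto simp: E_unitriangular)

lemma partial_prod_eq: "partial_prod A m = prod_mats (map E (map A [0..<m]))"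
  by (simp add: partial_prod_def o_def)

lemma unitriangular_partial_prod: "unitriangular (partial_prod A m)"
  unfolding partial_prod_eq by (rule unitriangular_prod_E)

lemma partial_prod_0 [simp]: "partial_prod A 0 = mat_one"
  by (simp add: partial_prod_def)

lemma partial_prod_add:
  "partial_prod A (k + m) = mat_mult (partial_prod A k) (partial_prod (\<lambda>l. A (l + k)) m)"
proof -
  have "map A [0..<k + m] = map A [0..<k] @ map (\<lambda>l. A (l + k)) [0..<m]"
    using upt_add_eq_append[of 0 k m] arg_cong[OF map_add_upt[of k m], of "map A"]
    by (simp add: add.commute o_def)
  then show ?thesis by (simp add: partial_prod_eq prod_E_append del: map_map map_append)
qed

lemma partial_prod_Suc: "partial_prod A (Suc m) = mat_mult (partial_prod A m) (E (A m))"
  using partial_prod_add[of A m 1] by (simp add: partial_prod_def mat_mult_one_right E_unitriangular)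

lemma partial_prod_Suc_left:
  "partial_prod A (Suc m) = mat_mult (E (A 0)) (partial_prod (\<lambda>l. A (Suc l)) m)"
  using partial_prod_add[of A 1 m] by (simp add: partial_prod_def mat_mult_one_right E_unitriangular)

lemma unitriangular_right_products: "P \<in> right_products \<Longrightarrow> unitriangular P"
  by (auto simp: right_products_def intro: unitriangular_mat_lim unitriangular_partial_prod)

lemma valid_seq_shift: "valid_seq A \<Longrightarrow> valid_seq (\<lambda>k. A (k + K))"
  by (auto simp: valid_seq_def summable_iff_shift[of "\<lambda>k. A k _" K])

lemma valid_seq_param: "valid_seq A \<Longrightarrow> positive_param n (A k)"
  by (simp add: valid_seq_def)

lemma summable_mass: "valid_seq A \<Longrightarrow> summable (\<lambda>k. mass n (A k))"
  unfolding valid_seq_def mass_def by (intro summable_sum) auto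

lemma dominated_partial_prod:
  assumes "\<And>k. positive_param n (A k)"
  shows "dominated (\<Sum>k<m. mass n (A k)) (partial_prod A m)"
proof (induction m)
  case (Suc m)
  have "dominated (mass n (A m)) (E (A m))"
    by (intro E_dominated le_mass n_pos assms)
  from dominated_mat_mult[OF unitriangular_partial_prod E_unitriangular Suc this]
  show ?case
    by (simp add: partial_prod_Suc sum_nonneg mass_nonneg assms)
qed (simp add: dominated_mat_one)

lemma partial_prod_mono:
  assumes "\<And>k. positive_param n (A k)" "m \<le> m'"
  shows "partial_prod A m i j \<le> partial_prod A m' i j"
proof -
  obtain d where d: "m' = m + d" using assms(2) le_Suc_ex by blast
  show ?thesis
    unfolding d partial_prod_add
    by (rule mat_mult_ge_left)
      (auto intro!: unitriangular_partial_prod dominatedD(1)[OF dominated_partial_prod] assms)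
qed

lemma partial_prod_dominated_suminf:
  assumes "valid_seq A"
  shows "dominated (\<Sum>k. mass n (A k)) (partial_prod A m)"
  using dominated_partial_prod[of A m] assms
  by (rule_tac dominated_mono)
    (auto simp: valid_seq_param mass_nonneg intro!: sum_nonneg sum_le_suminf summable_mass)

text \<open>Partial products increase entrywise and are bounded through the total mass.\<close>

lemma right_product_exists:
  assumes "valid_seq A"
  obtains P where "P \<in> right_products" "mat_lim (partial_prod A) P"
    "dominated (\<Sum>k. mass n (A k)) P"
proof -
  note dom = partial_prod_dominated_suminf[OF assms]
  have conv: "convergent (\<lambda>m. partial_prod A m i j)" for i j
  proof (cases "i \<le> j")
    case True
    have "incseq (\<lambda>m. partial_prod A m i j)"
      by (intro monoI partial_prod_mono valid_seq_param assms)
    then show ?thesis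
      using dominatedD(2)[OF dom True] incseq_convergent by (metis convergentI)
  next
    case False
    then have "(\<lambda>m. partial_prod A m i j) = (\<lambda>_. 0)"
      using unitriangularD(2)[OF unitriangular_partial_prod] by auto
    then show ?thesis by (simp add: convergent_const)
  qed
  define P where "P = (\<lambda>i j. lim (\<lambda>m. partial_prod A m i j))"
  have lim: "(\<lambda>m. partial_prod A m i j) \<longlonglongrightarrow> P i j" for i j
    unfolding P_def using conv by (simp add: convergent_LIMSEQ_iff)
  then have "mat_lim (partial_prod A) P" by (simp add: mat_lim_def)
  moreover have "dominated (\<Sum>k. mass n (A k)) P"
    unfolding dominated_def using dominatedD[OF dom]
    by (auto intro: LIMSEQ_le_const[OF lim] LIMSEQ_le_const2[OF lim])
  ultimately show ?thesis using that right_productsI assms by blast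
qed

text \<open>The bound on the tail is a remainder of the convergent series of masses, so it tends to \<open>0\<close> as \<open>K\<close> grows.\<close>

lemma right_product_split:
  assumes A: "valid_seq A" and P: "mat_lim (partial_prod A) P"
  obtains T where "T \<in> right_products" "mat_lim (partial_prod (\<lambda>k. A (k + K))) T"
    "P = mat_mult (partial_prod A K) T" "dominated (\<Sum>k. mass n (A (k + K))) T"
proof -
  obtain T where T: "T \<in> right_products" "mat_lim (partial_prod (\<lambda>k. A (k + K))) T"
    "dominated (\<Sum>k. mass n (A (k + K))) T"
    using right_product_exists[OF valid_seq_shift[OF A]] by metis
  have "mat_lim (\<lambda>m. partial_prod A (K + m)) (mat_mult (partial_prod A K) T)"
    unfolding partial_prod_add
    by (intro mat_lim_mat_mult mat_lim_const T unitriangular_partial_prod)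
  moreover have "mat_lim (\<lambda>m. partial_prod A (K + m)) P"
    by (rule mat_lim_subseq[OF P]) (simp add: strict_mono_def)
  ultimately show ?thesis using that T mat_lim_unique by metis
qed

lemma right_products_Cons:
  assumes "positive_param n p" "T \<in> right_products"
  shows "mat_mult (E p) T \<in> right_products"
proof -
  obtain A where A: "valid_seq A" "mat_lim (partial_prod A) T"
    using assms(2) by (auto simp: right_products_def)
  let ?B = "case_nat p A"
  have "summable (\<lambda>k. ?B k i)" for i
    using A(1) summable_Suc_iff[of "\<lambda>k. ?B k i"] by (simp add: valid_seq_def)
  then have "valid_seq ?B"
    using A(1) assms(1) by (auto simp: valid_seq_def split: nat.split)
  moreover have "mat_lim (\<lambda>m. partial_prod ?B (Suc m)) (mat_mult (E p) T)"
    unfolding partial_prod_Suc_left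
    by (simp add: mat_lim_mat_mult mat_lim_const A E_unitriangular unitriangular_partial_prod)
  then have "mat_lim (partial_prod ?B) (mat_mult (E p) T)"
    unfolding mat_lim_def using LIMSEQ_imp_Suc by fast
  ultimately show ?thesis by (rule right_productsI)
qed

lemma right_products_append:
  assumes "\<And>p. p \<in> set ps \<Longrightarrow> positive_param n p" "T \<in> right_products"
  shows "mat_mult (prod_mats (map E ps)) T \<in> right_products"
  using assms
proof (induction ps)
  case (Cons p ps)
  then show ?case
    by (simp add: mat_mult_assoc E_unitriangular unitriangular_prod_E unitriangular_right_products right_products_Cons)
qed (simp add: mat_mult_one_left unitriangular_right_products)

section \<open>Absorbing one factor on the right\<close>

text \<open>The parameter obtained from \<open>b\<close> after it has moved to the left through the \<open>t\<close> factors with indices \<open>m - 1\<close> down to \<open>m - t\<close>.\<close>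

fun pushed :: "(nat \<Rightarrow> int \<Rightarrow> real) \<Rightarrow> (int \<Rightarrow> real) \<Rightarrow> nat \<Rightarrow> nat \<Rightarrow> int \<Rightarrow> real" where
  "pushed A b m 0 = b"
| "pushed A b m (Suc t) = pushL (A (m - Suc t)) (pushed A b m t)"

text \<open>Since sums of parameters are preserved, the change of \<open>b\<close> equals \<open>a - a'\<close>, and both \<open>a\<close> and \<open>a'\<close> are of
the order of the mass of \<open>a\<close>.\<close>

lemma pushL_close:
  assumes a: "positive_param n a" and b: "positive_param n b"
    and d: "0 < d" "\<And>i. d \<le> b i" "\<And>i. b i \<le> D" "mass n a \<le> D"
  defines "C \<equiv> real n * (D / d) ^ (n - 1)"
  shows "\<bar>pushL a b i - b i\<bar> \<le> (1 + C) * mass n a" and "pushR a b i \<le> C * mass n a"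
proof -
  note ab = push_param[OF a b]
  note am = le_mass[OF n_pos a]
  show R: "pushR a b i \<le> C * mass n a"
    unfolding C_def using am d order_trans[OF am d(4)]
    by (intro pushR_le a b) auto
  have "0 \<le> C" using d(1) order_trans[OF d(2,3)] by (simp add: C_def)
  then have "0 \<le> C * mass n a" using mass_nonneg[OF a] by simp
  then show "\<bar>pushL a b i - b i\<bar> \<le> (1 + C) * mass n a"
    using push_sum[OF a b, of i] R am[of i] positive_paramD(2)[OF a, of i]
      positive_paramD(2)[OF conjunct2[OF ab], of i]
    by (simp add: distrib_right abs_le_iff)
qed

text \<open>The smallness condition is chosen so that \<open>b\<close> moves by at most \<open>d\<close> in total. Starting from at least \<open>2 * d\<close>
it then remains in the interval from \<open>d\<close> to \<open>mass n b + d\<close>, on which \<open>C\<close> is the constant of the exchange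
estimate; so the estimate can be used again at every step, however many factors are passed.\<close>

lemma right_products_mult_small:
  assumes A: "valid_seq A" and T: "mat_lim (partial_prod A) T"
    and b: "positive_param n b" and d: "0 < d" "\<And>i. 2 * d \<le> b i"
  defines "C \<equiv> real n * ((mass n b + d) / d) ^ (n - 1)"
  assumes small: "(1 + C) * (\<Sum>k. mass n (A k)) \<le> d"
  shows "mat_mult T (E b) \<in> right_products"
proof -
  define \<mu> where "\<mu> k = mass n (A k)" for k
  have A_param: "positive_param n (A k)" for k
    using A by (rule valid_seq_param)
  have \<mu>: "0 \<le> \<mu> k" "summable \<mu>" for k
    using summable_mass[OF A] mass_nonneg[OF A_param] unfolding \<mu>_def by auto
  have C: "0 \<le> C"
    using mass_nonneg[OF b] d(1) by (simp add: C_def)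
  have suffix_le: "(1 + C) * sum \<mu> {k..<m} \<le> d" for k m
  proof -
    have "sum \<mu> {k..<m} \<le> suminf \<mu>" by (intro sum_le_suminf \<mu>) auto
    then have "(1 + C) * sum \<mu> {k..<m} \<le> (1 + C) * suminf \<mu>"
      using C by (intro mult_left_mono) auto
    then show ?thesis using small by (simp add: \<mu>_def[abs_def])
  qed
  have \<mu>_le: "\<mu> k \<le> mass n b + d" for k
  proof -
    have "1 * \<mu> k \<le> (1 + C) * \<mu> k"
      using C \<mu> by (intro mult_right_mono) auto
    then show ?thesis using suffix_le[of k "Suc k"] mass_nonneg[OF b] by simp
  qed
  have near_b: "d \<le> p i" "p i \<le> mass n b + d"
    if "\<bar>p i - b i\<bar> \<le> d" for p i
    using that d(2)[of i] le_mass[OF n_pos b, of i] by auto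
  \<comment> \<open>The drift of \<open>b\<close> after passing some factors is bounded by their masses alone. Smallness keeps it below \<open>d\<close>, which makes the exchange estimate available for the next factor.\<close>
  have pushed: "positive_param n (pushed A b m t) \<and>
      (\<forall>i. \<bar>pushed A b m t i - b i\<bar> \<le> (1 + C) * sum \<mu> {m - t..<m})" if "t \<le> m" for m t
    using that
  proof (induction t)
    case (Suc t)
    let ?k = "m - Suc t" and ?p = "pushed A b m t"
    have k: "{?k..<m} = insert ?k {m - t..<m}" "?k \<notin> {m - t..<m}"
      using Suc.prems by auto
    have p: "positive_param n ?p" "\<bar>?p i - b i\<bar> \<le> (1 + C) * sum \<mu> {m - t..<m}" for i
      using Suc by auto
    then have p': "\<bar>?p i - b i\<bar> \<le> d" for i using suffix_le order_trans by blast
    have p'': "\<bar>pushL (A ?k) ?p i - ?p i\<bar> \<le> (1 + C) * \<mu> ?k" for i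
      unfolding C_def \<mu>_def
      by (intro pushL_close A_param p d near_b[of ?p, OF p'] \<mu>_le[unfolded \<mu>_def])
    have "\<bar>pushL (A ?k) ?p i - b i\<bar> \<le> (1 + C) * \<mu> ?k + (1 + C) * sum \<mu> {m - t..<m}" for i
      using p(2)[of i] p''[of i] by linarith
    then show ?case
      using push_param[OF A_param p(1)] k by (simp add: distrib_left)
  qed (simp add: b)
  \<comment> \<open>\<open>\<beta> m k\<close> is \<open>b\<close> on arrival between the factors \<open>k - 1\<close> and \<open>k\<close> when it starts after the factor \<open>m - 1\<close>; for \<open>k \<ge> m\<close> truncated subtraction makes it \<open>b\<close> itself.\<close>
  define \<beta> where "\<beta> m k = pushed A b m (m - k)" for m k
  have \<beta>_param: "positive_param n (\<beta> m k)" for m k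
    unfolding \<beta>_def using pushed[of "m - k" m] by simp
  have \<beta>_near: "\<bar>\<beta> m k i - b i\<bar> \<le> (1 + C) * sum \<mu> {k..<m}" for m k i
  proof (cases "k \<le> m")
    case True
    then show ?thesis using pushed[of "m - k" m] by (simp add: \<beta>_def)
  qed (simp add: \<beta>_def)
  have \<beta>_rec: "\<beta> m k = pushL (A k) (\<beta> m (Suc k))" if "k < m" for m k
  proof -
    have "m - k = Suc (m - Suc k)" using that by simp
    then show ?thesis using that by (simp add: \<beta>_def)
  qed
  have \<beta>_d: "\<bar>\<beta> m k i - b i\<bar> \<le> d" for m k i
    using \<beta>_near suffix_le order_trans by blast
  have \<beta>_bounds: "d \<le> \<beta> m k i" "\<beta> m k i \<le> mass n b + d" for m k i
    by (rule near_b[of "\<beta> m k" i, OF \<beta>_d])+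
  obtain r B where r: "strict_mono r" and B: "\<And>k i. (\<lambda>m. \<beta> (r m) k i) \<longlonglongrightarrow> B k i"
    using bounded_array_convergent_subsequence[of d \<beta>, OF \<beta>_bounds] by metis
  \<comment> \<open>The drift bound survives the limit, with the mass of the whole tail in place of a finite stretch. Hence \<open>B k\<close> tends to \<open>b\<close>.\<close>
  have B_near: "\<bar>B k i - b i\<bar> \<le> (1 + C) * (\<Sum>j. \<mu> (j + k))" for k i
  proof (rule LIMSEQ_le_const2)
    show "(\<lambda>m. \<bar>\<beta> (r m) k i - b i\<bar>) \<longlonglongrightarrow> \<bar>B k i - b i\<bar>"
      by (intro tendsto_rabs tendsto_diff B tendsto_const)
    have "sum \<mu> {k..<m} \<le> (\<Sum>j. \<mu> (j + k))" for m
    proof -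
      have "sum \<mu> {k..<m} = (\<Sum>j<m - k. \<mu> (j + k))"
        by (rule sum.reindex_bij_witness[of _ "\<lambda>j. j + k" "\<lambda>j. j - k"]) auto
      also have "\<dots> \<le> (\<Sum>j. \<mu> (j + k))"
        using \<mu> by (intro sum_le_suminf) (auto simp: summable_iff_shift)
      finally show ?thesis .
    qed
    then show "\<exists>N. \<forall>m\<ge>N. \<bar>\<beta> (r m) k i - b i\<bar> \<le> (1 + C) * (\<Sum>j. \<mu> (j + k))"
      using C by (intro exI[of _ 0] allI impI order_trans[OF \<beta>_near] mult_left_mono) auto
  qed
  have B_d: "\<bar>B k i - b i\<bar> \<le> d" for k i
    using \<beta>_d by (intro LIMSEQ_le_const2[OF tendsto_rabs[OF tendsto_diff[OF B tendsto_const]]]) auto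
  have B_bounds: "d \<le> B k i" "B k i \<le> mass n b + d" for k i
    by (rule near_b[of "B k" i, OF B_d])+
  have B_param: "positive_param n (B k)" for k
  proof -
    have "B k (i + int n) = B k i" for i
      using LIMSEQ_unique[OF B[of k "i + int n"]] B[of k i] positive_paramD(1)[OF \<beta>_param] by simp
    then show ?thesis
      unfolding positive_param_def using B_bounds(1) d(1) less_le_trans by blast
  qed
  \<comment> \<open>By continuity the exchange relation passes to the limit.\<close>
  have B_rec: "B k = pushL (A k) (B (Suc k))" for k
  proof
    fix i
    have "(\<lambda>m. pushL (A k) (\<beta> (r m) (Suc k)) i) \<longlonglongrightarrow> pushL (A k) (B (Suc k)) i"
      by (intro pushL_tendsto A_param B_param B)
    moreover have "eventually (\<lambda>m. pushL (A k) (\<beta> (r m) (Suc k)) i = \<beta> (r m) k i) sequentially"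
      using eventually_gt_at_top[of k]
      by eventually_elim (use seq_suble[OF r] \<beta>_rec in \<open>metis order_less_le_trans\<close>)
    ultimately have "(\<lambda>m. \<beta> (r m) k i) \<longlonglongrightarrow> pushL (A k) (B (Suc k)) i"
      using tendsto_cong by force
    then show "B k i = pushL (A k) (B (Suc k)) i"
      using B LIMSEQ_unique by blast
  qed
  have B_lim: "(\<lambda>k. B k i) \<longlonglongrightarrow> b i" for i
  proof -
    have "(\<lambda>k. (1 + C) * (\<Sum>j. \<mu> (j + k))) \<longlonglongrightarrow> (1 + C) * 0"
      by (intro tendsto_mult tendsto_const suminf_exist_split2 \<mu>)
    then have lim: "(\<lambda>k. (1 + C) * (\<Sum>j. \<mu> (j + k))) \<longlonglongrightarrow> 0"
      unfolding mult_zero_right .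
    have "\<forall>k. norm (B k i - b i) \<le> (1 + C) * (\<Sum>j. \<mu> (j + k))"
      using B_near by (simp only: real_norm_def) blast
    from Lim_null_comparison[OF always_eventually[OF this] lim]
    have "(\<lambda>k. B k i - b i) \<longlonglongrightarrow> 0" .
    then show ?thesis by (simp add: LIM_zero_iff)
  qed
  define A' where "A' k = pushR (A k) (B (Suc k))" for k
  have A'_param: "positive_param n (A' k)" for k
    unfolding A'_def using push_param[OF A_param B_param] by simp
  have A'_le: "A' k i \<le> C * \<mu> k" for k i
    unfolding A'_def C_def \<mu>_def
    using pushL_close(2)[OF A_param B_param d(1) B_bounds \<mu>_le[unfolded \<mu>_def]] by simp
  have "summable (\<lambda>k. A' k i)" for i
    using A'_le positive_paramD(2)[OF A'_param]
    by (intro summable_comparison_test'[OF summable_mult[OF \<mu>(2), of C], of 0]) (simp add: less_imp_le abs_of_pos)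
  then have A'_valid: "valid_seq A'" by (simp add: valid_seq_def A'_param)
  obtain T' where T': "T' \<in> right_products" "mat_lim (partial_prod A') T'"
    using right_product_exists[OF A'_valid] by metis
  \<comment> \<open>In \<open>A\<^sub>0 \<cdots> A\<^sub>m\<^sub>-\<^sub>1 B\<^sub>m\<close> the last factor moves to the front, turning each \<open>A\<^sub>k\<close> into \<open>A'\<^sub>k\<close>; both sides converge as \<open>m\<close> grows.\<close>
  have passed: "mat_mult (partial_prod A m) (E (B m)) = mat_mult (E (B 0)) (partial_prod A' m)" for m
  proof (induction m)
    case (Suc m)
    have "mat_mult (partial_prod A (Suc m)) (E (B (Suc m)))
        = mat_mult (partial_prod A m) (mat_mult (E (A m)) (E (B (Suc m))))"
      by (simp add: partial_prod_Suc mat_mult_assoc unitriangular_partial_prod E_unitriangular)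
    also have "mat_mult (E (A m)) (E (B (Suc m))) = mat_mult (E (B m)) (E (A' m))"
      using push_eq[OF A_param B_param] B_rec[of m] by (simp add: A'_def)
    also have "mat_mult (partial_prod A m) \<dots> = mat_mult (E (B 0)) (partial_prod A' (Suc m))"
      using Suc.IH
      by (simp add: partial_prod_Suc unitriangular_partial_prod E_unitriangular unitriangular_mat_mult flip: mat_mult_assoc)
    finally show ?case .
  qed (simp add: mat_mult_one_left mat_mult_one_right E_unitriangular)
  have "mat_lim (\<lambda>m. mat_mult (partial_prod A m) (E (B m))) (mat_mult T (E b))"
    by (intro mat_lim_mat_mult T E_tendsto B_lim unitriangular_partial_prod E_unitriangular)
  moreover have "mat_lim (\<lambda>m. mat_mult (E (B 0)) (partial_prod A' m)) (mat_mult (E (B 0)) T')"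
    by (intro mat_lim_mat_mult mat_lim_const T' unitriangular_partial_prod E_unitriangular)
  ultimately have "mat_mult T (E b) = mat_mult (E (B 0)) T'"
    unfolding passed by (rule mat_lim_unique)
  then show ?thesis using right_products_Cons[OF B_param T'(1)] by simp
qed

text \<open>Smallness holds for the tail after a sufficiently long prefix, and the prefix is put back in front afterwards.\<close>

lemma right_products_mult_factor:
  assumes P: "P \<in> right_products" and b: "positive_param n b"
  shows "mat_mult P (E b) \<in> right_products"
proof -
  obtain A where A: "valid_seq A" "mat_lim (partial_prod A) P"
    using P by (auto simp: right_products_def)
  obtain d' where d': "0 < d'" "\<And>i. d' \<le> b i"
    using positive_param_bounded_below[OF n_pos b] by metis
  define d where "d = d' / 2"
  define C where "C = real n * ((mass n b + d) / d) ^ (n - 1)"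
  have "(\<lambda>K. (1 + C) * (\<Sum>k. mass n (A (k + K)))) \<longlonglongrightarrow> (1 + C) * 0"
    by (intro tendsto_mult tendsto_const suminf_exist_split2 summable_mass A)
  then have "eventually (\<lambda>K. (1 + C) * (\<Sum>k. mass n (A (k + K))) < d) sequentially"
    using d' by (intro order_tendstoD) (auto simp: d_def)
  then obtain K where K: "(1 + C) * (\<Sum>k. mass n (A (k + K))) < d"
    by (auto simp: eventually_sequentially)
  obtain T where T: "T \<in> right_products" "mat_lim (partial_prod (\<lambda>k. A (k + K))) T"
    "P = mat_mult (partial_prod A K) T"
    using right_product_split[OF A] by metis
  have "mat_mult T (E b) \<in> right_products"
    using d' K by (intro right_products_mult_small[OF valid_seq_shift[OF A(1), of K] T(2) b, of d])
      (auto simp: d_def C_def)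
  then have "mat_mult (prod_mats (map E (map A [0..<K]))) (mat_mult T (E b)) \<in> right_products"
    using valid_seq_param[OF A(1)] by (intro right_products_append) auto
  then show ?thesis
    using T(1) by (simp only: T(3) partial_prod_eq)
      (simp only: mat_mult_assoc unitriangular_prod_E unitriangular_right_products E_unitriangular)
qed

end

section \<open>Closure under multiplication\<close>

text \<open>Concatenation of infinitely many nonempty lists to one infinite sequence, together with the positions \<open>length (concat ...)\<close> at which the blocks end.\<close>

lemma concat_prefix_stream:
  fixes L :: "nat \<Rightarrow> 'a list"
  assumes ne: "\<And>j. L j \<noteq> []"
  obtains s where "\<And>j. map s [0..<length (concat (map L [0..<j]))] = concat (map L [0..<j])"
    "strict_mono (\<lambda>j. length (concat (map L [0..<j])))" "range s \<subseteq> (\<Union>j. set (L j))"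
proof -
  define G where "G j = concat (map L [0..<j])" for j
  define s where "s i = G (Suc i) ! i" for i
  have G_Suc: "G (Suc j) = G j @ L j" for j by (simp add: G_def)
  have mono: "strict_mono (\<lambda>j. length (G j))"
    by (rule strict_monoI_Suc) (simp add: G_Suc ne)
  have long: "i < length (G (Suc i))" for i
    using strict_mono_imp_increasing[OF mono, of "Suc i"] by simp
  have prefix: "\<exists>zs. G (j + t) = G j @ zs" for j t
    by (induction t) (auto simp: G_Suc)
  have s_eq: "s i = G j ! i" if "i < length (G j)" for i j
  proof (cases "j \<le> Suc i")
    case True
    then obtain zs where "G (Suc i) = G j @ zs"
      using prefix[of j "Suc i - j"] by auto
    then show ?thesis using that by (simp add: s_def nth_append)
  next
    case False
    then obtain zs where "G j = G (Suc i) @ zs"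
      using prefix[of "Suc i" "j - Suc i"] by auto
    then show ?thesis using long[of i] by (simp add: s_def nth_append)
  qed
  show ?thesis
  proof (rule that)
    show "map s [0..<length (concat (map L [0..<j]))] = concat (map L [0..<j])" for j
      unfolding G_def[symmetric] by (rule nth_equalityI) (auto simp: s_eq)
    show "strict_mono (\<lambda>j. length (concat (map L [0..<j])))"
      using mono by (simp add: G_def)
    show "range s \<subseteq> (\<Union>j. set (L j))"
    proof
      fix x assume "x \<in> range s"
      then obtain i where "x = G (Suc i) ! i" by (auto simp: s_def)
      then have "x \<in> set (G (Suc i))" using long nth_mem by metis
      then show "x \<in> (\<Union>j. set (L j))" by (auto simp: G_def)
    qed
  qed
qed

context factor_family
begin

text \<open>A finite prefix can be split off so that the rest is as close to the identity as desired.\<close>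

lemma right_products_peel:
  assumes P: "P \<in> right_products" and "0 < e"
  obtains ps T where "ps \<noteq> []" "\<And>p. p \<in> set ps \<Longrightarrow> positive_param n p"
    "T \<in> right_products" "dominated e T" "P = mat_mult (prod_mats (map E ps)) T"
proof -
  obtain A where A: "valid_seq A" "mat_lim (partial_prod A) P"
    using P by (auto simp: right_products_def)
  have "(\<lambda>K. \<Sum>k. mass n (A (k + K))) \<longlonglongrightarrow> 0"
    by (intro suminf_exist_split2 summable_mass A)
  then have "eventually (\<lambda>K. (\<Sum>k. mass n (A (k + K))) < e \<and> 0 < K) sequentially"
    using \<open>0 < e\<close> by (intro eventually_conj order_tendstoD eventually_gt_at_top)
  then obtain K where K: "(\<Sum>k. mass n (A (k + K))) < e" "0 < K"
    by (auto simp: eventually_sequentially)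
  obtain T where T: "T \<in> right_products" "P = mat_mult (partial_prod A K) T"
    "dominated (\<Sum>k. mass n (A (k + K))) T"
    using right_product_split[OF A] by metis
  have "dominated e T"
    using K(1) T(3) summable_mass[OF valid_seq_shift[OF A(1), of K]] mass_nonneg[OF valid_seq_param[OF A(1)]]
    by (intro dominated_mono[OF T(3)] suminf_nonneg) auto
  then show ?thesis
    using that[of "map A [0..<K]" T] T K valid_seq_param[OF A(1)] by (auto simp: partial_prod_eq)
qed

lemma partial_prod_superdiagonal:
  assumes "\<And>k. positive_param n (A k)"
  shows "partial_prod A m i (i + 1) = (\<Sum>k<m. A k i)"
  by (induction m)
    (simp_all add: partial_prod_Suc mat_mult_superdiagonal unitriangular_partial_prod
      E_unitriangular E_superdiagonal assms, simp add: mat_one_def)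

lemma partial_prod_le_limit:
  assumes "valid_seq A" "mat_lim (partial_prod A) P"
  shows "partial_prod A m i j \<le> P i j"
proof (rule incseq_le)
  show "incseq (\<lambda>m. partial_prod A m i j)"
    using assms(1) by (intro monoI partial_prod_mono valid_seq_param)
qed (use assms(2) in \<open>simp add: mat_lim_def\<close>)

text \<open>The factors of \<open>Q\<close> are absorbed into \<open>P\<close> one by one. Shrinking the remainder after each absorption prevents
mass from escaping to infinity: it forces the emitted factors to account for the whole product in the limit.\<close>

lemma right_products_mult_closed:
  assumes P: "P \<in> right_products" and Q: "Q \<in> right_products"
  shows "mat_mult P Q \<in> right_products"
proof -
  obtain B where B: "valid_seq B" "mat_lim (partial_prod B) Q"
    using Q by (auto simp: right_products_def)
  have "\<exists>T. \<forall>j::nat. T j \<in> right_products \<and> (j = 0 \<longrightarrow> T j = P) \<and>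
      (\<exists>ps. ps \<noteq> [] \<and> (\<forall>p\<in>set ps. positive_param n p) \<and> dominated (1 / real (Suc j)) (T (Suc j)) \<and>
        mat_mult (T j) (E (B j)) = mat_mult (prod_mats (map E ps)) (T (Suc j)))"
  proof (rule dependent_nat_choice[where
        P = "\<lambda>j T. T \<in> right_products \<and> (j = 0 \<longrightarrow> T = P)" and
        Q = "\<lambda>j T T'. \<exists>ps. ps \<noteq> [] \<and> (\<forall>p\<in>set ps. positive_param n p) \<and> dominated (1 / real (Suc j)) T' \<and>
          mat_mult T (E (B j)) = mat_mult (prod_mats (map E ps)) T'", unfolded conj_assoc])
    show "\<exists>T. T \<in> right_products \<and> (0 = (0::nat) \<longrightarrow> T = P)" using P by blast
    fix T and j :: nat assume "T \<in> right_products \<and> (j = 0 \<longrightarrow> T = P)"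
    then have "mat_mult T (E (B j)) \<in> right_products"
      using right_products_mult_factor valid_seq_param[OF B(1)] by blast
    then show "\<exists>T'. T' \<in> right_products \<and> (Suc j = 0 \<longrightarrow> T' = P) \<and>
        (\<exists>ps. ps \<noteq> [] \<and> (\<forall>p\<in>set ps. positive_param n p) \<and> dominated (1 / real (Suc j)) T' \<and>
          mat_mult T (E (B j)) = mat_mult (prod_mats (map E ps)) T')"
      by (rule right_products_peel[where e = "1 / real (Suc j)"]) auto
  qed
  then obtain T L where T: "\<And>j. T j \<in> right_products" "T 0 = P"
    and L: "\<And>j. L j \<noteq> []" "\<And>j p. p \<in> set (L j) \<Longrightarrow> positive_param n p"
    and T_dom: "\<And>j. dominated (1 / real (Suc j)) (T (Suc j))"
    and step: "\<And>j. mat_mult (T j) (E (B j)) = mat_mult (prod_mats (map E (L j))) (T (Suc j))"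
    by metis
  define len where "len j = length (concat (map L [0..<j]))" for j
  obtain s where s: "\<And>j. map s [0..<len j] = concat (map L [0..<j])" "strict_mono len"
    "range s \<subseteq> (\<Union>j. set (L j))"
    unfolding len_def using concat_prefix_stream[of L, OF L(1)] by metis
  have s_param: "positive_param n (s k)" for k
    using s(3) L(2) by blast
  have uT: "unitriangular (T j)" for j
    by (rule unitriangular_right_products[OF T(1)])
  have uP: "unitriangular P" and uQ: "unitriangular Q"
    using P Q by (auto intro: unitriangular_right_products)
  have PQ: "mat_mult (partial_prod s (len j)) (T j) = mat_mult P (partial_prod B j)" for j
  proof (induction j)
    case 0
    then show ?case by (simp add: len_def T uP mat_mult_one_left mat_mult_one_right)
  next
    case (Suc j)
    have "concat (map L [0..<Suc j]) = concat (map L [0..<j]) @ L j" by simp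
    then have "partial_prod s (len (Suc j)) = mat_mult (partial_prod s (len j)) (prod_mats (map E (L j)))"
      unfolding partial_prod_eq s(1) by (simp only: prod_E_append)
    then have "mat_mult (partial_prod s (len (Suc j))) (T (Suc j))
        = mat_mult (partial_prod s (len j)) (mat_mult (T j) (E (B j)))"
      by (simp add: step mat_mult_assoc unitriangular_partial_prod unitriangular_prod_E uT)
    also have "\<dots> = mat_mult P (partial_prod B (Suc j))"
      by (simp add: Suc.IH partial_prod_Suc unitriangular_partial_prod E_unitriangular uT uP flip: mat_mult_assoc)
    finally show ?case .
  qed
  have nonneg: "0 \<le> R i j" if "R \<in> right_products" for R i j
    using that dominatedD(1) right_product_exists mat_lim_unique
    unfolding right_products_def mem_Collect_eq by metis
  \<comment> \<open>The entries next to the diagonal record the sums of all parameters emitted so far, and these entries never exceed those of \<open>P Q\<close>. This is what makes the emitted sequence summable.\<close>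
  have bound: "partial_prod s m i (i + 1) \<le> mat_mult P Q i (i + 1)" for m i
  proof -
    have "m \<le> len m" by (rule strict_mono_imp_increasing[OF s(2)])
    then have "partial_prod s m i (i + 1) \<le> partial_prod s (len m) i (i + 1)"
      by (intro partial_prod_mono s_param)
    also have "\<dots> \<le> partial_prod s (len m) i (i + 1) + T m i (i + 1)"
      using nonneg[OF T(1)] by simp
    also have "\<dots> = P i (i + 1) + partial_prod B m i (i + 1)"
      using arg_cong[OF PQ[of m], of "\<lambda>X. X i (i + 1)"]
      by (simp add: mat_mult_superdiagonal unitriangular_partial_prod uT uP)
    also have "\<dots> \<le> mat_mult P Q i (i + 1)"
      using partial_prod_le_limit[OF B] by (simp add: mat_mult_superdiagonal uP uQ)
    finally show ?thesis .
  qed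
  have "summable (\<lambda>k. s k i)" for i
  proof (rule summableI_nonneg_bounded)
    show "0 \<le> s k i" for k using positive_paramD(2)[OF s_param] less_imp_le by blast
    show "(\<Sum>k<m. s k i) \<le> mat_mult P Q i (i + 1)" for m
      using bound[of m i] by (simp add: partial_prod_superdiagonal s_param)
  qed
  then have s_valid: "valid_seq s" by (simp add: valid_seq_def s_param)
  obtain W where W: "W \<in> right_products" "mat_lim (partial_prod s) W"
    using right_product_exists[OF s_valid] by metis
  have "mat_lim (\<lambda>j. T (Suc j)) mat_one"
    by (rule dominated_mat_lim_one[OF T_dom uT]) (rule LIMSEQ_inverse_real_of_nat[unfolded inverse_eq_divide])
  then have "mat_lim (\<lambda>j. mat_mult (partial_prod s (len (Suc j))) (T (Suc j))) (mat_mult W mat_one)"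
    using s(2) by (intro mat_lim_mat_mult mat_lim_subseq[OF W(2), of "\<lambda>j. len (Suc j)"] unitriangular_partial_prod uT)
      (auto simp: strict_mono_def)
  moreover have "mat_lim (\<lambda>j. mat_mult P (partial_prod B (Suc j))) (mat_mult P Q)"
    by (intro mat_lim_mat_mult mat_lim_const mat_lim_subseq[OF B(2), of Suc] unitriangular_partial_prod uP)
      (simp add: strict_monoI_Suc)
  ultimately have "mat_mult P Q = mat_mult W mat_one"
    unfolding PQ using mat_lim_unique by blast
  then show ?thesis using W(1) by (simp add: mat_mult_one_right unitriangular_right_products)
qed

section \<open>Left-infinite products by reversal\<close>

definition left_products :: "zmat set" where
  "left_products = {P. \<exists>A. valid_seq A \<and>
     mat_lim (\<lambda>m. prod_mats (rev (map (\<lambda>k. E (A k)) [0..<m]))) P}"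

lemma valid_seq_reverse: "valid_seq A \<Longrightarrow> valid_seq (\<lambda>k i. A k (- 1 - i))"
  by (auto simp: valid_seq_def positive_param_reverse)

lemma mat_reverse_partial_prod:
  assumes "valid_seq A"
  shows "mat_reverse (partial_prod A m) = prod_mats (rev (map (\<lambda>k. E (\<lambda>i. A k (- 1 - i))) [0..<m]))"
  unfolding partial_prod_def
  by (subst mat_reverse_prod_mats) (auto simp: E_unitriangular o_def E_reverse valid_seq_param[OF assms])

lemma left_products_iff: "P \<in> left_products \<longleftrightarrow> mat_reverse P \<in> right_products"
proof
  assume "P \<in> left_products"
  then obtain A where A: "valid_seq A" "mat_lim (\<lambda>m. prod_mats (rev (map (\<lambda>k. E (A k)) [0..<m]))) P"
    by (auto simp: left_products_def)
  let ?A = "\<lambda>k i. A k (- 1 - i)"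
  have "partial_prod ?A m = mat_reverse (prod_mats (rev (map (\<lambda>k. E (A k)) [0..<m])))" for m
    using arg_cong[OF mat_reverse_partial_prod[OF valid_seq_reverse[OF A(1)], of m], of mat_reverse] by simp
  then have "mat_lim (partial_prod ?A) (mat_reverse P)"
    using mat_lim_reverse[OF A(2)] by presburger
  then show "mat_reverse P \<in> right_products"
    by (rule right_productsI[OF valid_seq_reverse[OF A(1)]])
next
  assume "mat_reverse P \<in> right_products"
  then obtain A where A: "valid_seq A" "mat_lim (partial_prod A) (mat_reverse P)"
    by (auto simp: right_products_def)
  show "P \<in> left_products"
    unfolding left_products_def
    using valid_seq_reverse[OF A(1)] mat_lim_reverse[OF A(2)]
    by (auto simp: mat_reverse_partial_prod[OF A(1)])
qed

lemma semigroup_right_products: "semigroup_on right_products mat_mult"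
  unfolding semigroup_on_def
  by (simp add: right_products_mult_closed mat_mult_assoc unitriangular_right_products)

lemma unitriangular_left_products: "P \<in> left_products \<Longrightarrow> unitriangular P"
  using unitriangular_mat_reverse[of "mat_reverse P"] left_products_iff[of P]
  by (simp add: unitriangular_right_products)

lemma semigroup_left_products: "semigroup_on left_products mat_mult"
  unfolding semigroup_on_def
proof (intro conjI ballI)
  fix P Q assume "P \<in> left_products" "Q \<in> left_products"
  then have "mat_mult (mat_reverse Q) (mat_reverse P) \<in> right_products"
    using right_products_mult_closed left_products_iff by blast
  then show "mat_mult P Q \<in> left_products"
    using \<open>P \<in> left_products\<close> \<open>Q \<in> left_products\<close>
    by (simp only: left_products_iff[of "mat_mult P Q"] mat_reverse_mult unitriangular_left_products)
qed (simp add: mat_mult_assoc unitriangular_left_products)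

end

section \<open>The exchange map for whirls and curls\<close>

text \<open>The exchange equations \<open>b' i + a' i = a i + b i\<close> and \<open>b' i * a' (i + 1) = a i * b (i + 1)\<close> say that the two
products of whirls agree. The second one holds for every choice of nonzero periodic weights \<open>\<kappa>\<close> in
\<open>b' i = b (i + 1) * \<kappa> (i + 1) / \<kappa> i\<close> and \<open>a' i = a (i - 1) * \<kappa> (i - 1) / \<kappa> i\<close>. The first one then holds if
\<open>b (i + 1) * \<kappa> (i + 1) - a i * \<kappa> i\<close> does not depend on \<open>i\<close>, and the following positive sum has this property:
each summand uses \<open>b\<close> on an initial stretch of the \<open>n - 1\<close> positions after \<open>i\<close> and \<open>a\<close> on the rest.\<close>

definition kappa :: "nat \<Rightarrow> (int \<Rightarrow> real) \<Rightarrow> (int \<Rightarrow> real) \<Rightarrow> int \<Rightarrow> real" where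
  "kappa n a b i = (\<Sum>r<n. (\<Prod>k<r. b (i + 1 + int k)) * (\<Prod>k=Suc r..<n. a (i + int k)))"

definition whirlL :: "nat \<Rightarrow> (int \<Rightarrow> real) \<Rightarrow> (int \<Rightarrow> real) \<Rightarrow> int \<Rightarrow> real" where
  "whirlL n a b i = b (i + 1) * kappa n a b (i + 1) / kappa n a b i"

definition whirlR :: "nat \<Rightarrow> (int \<Rightarrow> real) \<Rightarrow> (int \<Rightarrow> real) \<Rightarrow> int \<Rightarrow> real" where
  "whirlR n a b i = a (i - 1) * kappa n a b (i - 1) / kappa n a b i"

lemma kappa_pos:
  assumes "1 \<le> n" "positive_param n a" "positive_param n b"
  shows "0 < kappa n a b i"
  unfolding kappa_def using assms
  by (intro sum_pos mult_pos_pos prod_pos) (auto simp: positive_paramD lessThan_empty_iff)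

lemma kappa_periodic:
  assumes "positive_param n a" "positive_param n b"
  shows "kappa n a b (i + int n) = kappa n a b i"
proof -
  have "b (i + int n + 1 + k) = b (i + 1 + k)" "a (i + int n + k) = a (i + k)" for k
    using positive_paramD(1)[OF assms(1), of "i + k"] positive_paramD(1)[OF assms(2), of "i + 1 + k"]
    by (simp_all add: algebra_simps)
  then show ?thesis by (simp add: kappa_def)
qed

lemma prod_period_shift:
  assumes "positive_param n a"
  shows "(\<Prod>k<n. a (i + 1 + int k)) = (\<Prod>k<n. a (i + int k))"
proof -
  have "a i * (\<Prod>k<n. a (i + 1 + int k)) = (\<Prod>k<Suc n. a (i + int k))"
    by (simp only: prod.lessThan_Suc_shift) (simp add: algebra_simps)
  also have "\<dots> = a i * (\<Prod>k<n. a (i + int k))"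
    using positive_paramD(1)[OF assms, of i] by simp
  finally show ?thesis using positive_paramD(2)[OF assms, of i] by simp
qed

text \<open>Both \<open>b (i + 1) * kappa n a b (i + 1)\<close> and \<open>a i * kappa n a b i\<close> are sums over the same \<open>n + 1\<close> mixed products on the positions \<open>i + 1\<close>, ..., \<open>i + n\<close>, each lacking one extreme: the pure product of \<open>a\<close> and the pure product of \<open>b\<close>, respectively.\<close>

lemma kappa_step:
  assumes "positive_param n a"
  shows "b (i + 1) * kappa n a b (i + 1) + (\<Prod>k<n. a (i + 1 + int k))
       = a i * kappa n a b i + (\<Prod>k<n. b (i + 1 + int k))"
proof -
  define F where "F r = (\<Prod>k<r. b (i + 1 + int k)) * (\<Prod>k=r..<n. a (i + 1 + int k))" for r
  have "b (i + 1) * ((\<Prod>k<r. b (i + 1 + 1 + int k)) * (\<Prod>k=Suc r..<n. a (i + 1 + int k))) = F (Suc r)" for r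
    unfolding F_def prod.lessThan_Suc_shift by (simp add: algebra_simps)
  then have "b (i + 1) * kappa n a b (i + 1) = (\<Sum>r<n. F (Suc r))"
    by (simp add: kappa_def sum_distrib_left)
  moreover have "a i * ((\<Prod>k<r. b (i + 1 + int k)) * (\<Prod>k=Suc r..<n. a (i + int k))) = F r" if "r < n" for r
  proof -
    have "(\<Prod>k=Suc r..<Suc n. a (i + int k)) = (\<Prod>k=r..<n. a (i + 1 + int k))"
      unfolding prod.shift_bounds_Suc_ivl by (simp add: algebra_simps)
    then have "a i * (\<Prod>k=Suc r..<n. a (i + int k)) = (\<Prod>k=r..<n. a (i + 1 + int k))"
      using that positive_paramD(1)[OF assms, of i] by (simp add: mult.commute)
    then show ?thesis unfolding F_def by (simp add: mult.left_commute)
  qed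
  then have "a i * kappa n a b i = (\<Sum>r<n. F r)"
    by (simp add: kappa_def sum_distrib_left)
  moreover have "(\<Sum>r<n. F (Suc r)) + F 0 = (\<Sum>r<n. F r) + F n"
    using sum.lessThan_Suc_shift[of F n] sum.lessThan_Suc[of F n] by simp
  ultimately show ?thesis
    by (simp add: F_def atLeast0LessThan)
qed

lemma whirl_push_param:
  assumes "1 \<le> n" "positive_param n a" "positive_param n b"
  shows "positive_param n (whirlL n a b)" "positive_param n (whirlR n a b)"
proof -
  note \<kappa> = kappa_pos[OF assms] and per = kappa_periodic[OF assms(2,3)]
  note ap = positive_paramD[OF assms(2)] and bp = positive_paramD[OF assms(3)]
  have "b (i + int n + 1) = b (i + 1)" "kappa n a b (i + int n + 1) = kappa n a b (i + 1)"
    "a (i + int n - 1) = a (i - 1)" "kappa n a b (i + int n - 1) = kappa n a b (i - 1)" for i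
    using bp(1)[of "i + 1"] per[of "i + 1"] ap(1)[of "i - 1"] per[of "i - 1"] by (simp_all add: algebra_simps)
  then show "positive_param n (whirlL n a b)" "positive_param n (whirlR n a b)"
    unfolding positive_param_def whirlL_def whirlR_def using \<kappa> ap(2) bp(2) per
    by (auto intro!: divide_pos_pos mult_pos_pos)
qed

text \<open>The constant difference in \<open>kappa_step\<close> is the product of \<open>b\<close> minus that of \<open>a\<close> over a period, so it is the same at \<open>i\<close> and at \<open>i - 1\<close> and cancels.\<close>

lemma whirl_push_sum:
  assumes "1 \<le> n" "positive_param n a" "positive_param n b"
  shows "whirlL n a b i + whirlR n a b i = a i + b i"
proof -
  have "b (i + 1) * kappa n a b (i + 1) + a (i - 1) * kappa n a b (i - 1) = (a i + b i) * kappa n a b i"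
    using kappa_step[OF assms(2), of b i] kappa_step[OF assms(2), of b "i - 1"]
      prod_period_shift[OF assms(2), of i] prod_period_shift[OF assms(3), of i]
    by (simp add: algebra_simps)
  then show ?thesis
    using kappa_pos[OF assms, of i] by (simp add: whirlL_def whirlR_def add_divide_distrib[symmetric])
qed

lemma whirl_push_mult:
  assumes "1 \<le> n" "positive_param n a" "positive_param n b"
  shows "whirlL n a b i * whirlR n a b (i + 1) = a i * b (i + 1)"
  using kappa_pos[OF assms, of i] kappa_pos[OF assms, of "i + 1"] by (simp add: whirlL_def whirlR_def)

lemma whirl_unitriangular: "unitriangular (whirl n p)"
  by (auto simp: unitriangular_def whirl_def)

lemma curl_unitriangular: "unitriangular (curl n p)"
  by (auto simp: unitriangular_def curl_def)

lemma mat_mult_whirl_right: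
  assumes "unitriangular X"
  shows "mat_mult X (whirl n p) i j = X i j + X i (j - 1) * p (cyc n (j - 1))"
proof -
  have "mat_mult X (whirl n p) i j = (\<Sum>k\<in>{i..j}. (if k = j then X i j else 0) + (if k = j - 1 then X i (j - 1) * p (cyc n (j - 1)) else 0))"
    unfolding mat_mult_eq_sum[OF assms whirl_unitriangular]
    by (rule sum.cong) (auto simp: whirl_def)
  also have "\<dots> = X i j + X i (j - 1) * p (cyc n (j - 1))"
    using unitriangularD(2)[OF assms, of j i] unitriangularD(2)[OF assms, of "j - 1" i]
    by (auto simp: sum.distrib)
  finally show ?thesis .
qed

lemma mat_mult_whirl_left:
  assumes "unitriangular X"
  shows "mat_mult (whirl n p) X i j = X i j + p (cyc n i) * X (i + 1) j"
proof -
  have "mat_mult (whirl n p) X i j = (\<Sum>k\<in>{i..j}. (if k = i then X i j else 0) + (if k = i + 1 then p (cyc n i) * X (i + 1) j else 0))"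
    unfolding mat_mult_eq_sum[OF whirl_unitriangular assms]
    by (rule sum.cong) (auto simp: whirl_def)
  also have "\<dots> = X i j + p (cyc n i) * X (i + 1) j"
    using unitriangularD(2)[OF assms, of j i] unitriangularD(2)[OF assms, of j "i + 1"]
    by (auto simp: sum.distrib)
  finally show ?thesis .
qed

lemma whirl_mult_eqI:
  assumes sum: "\<And>i. a (cyc n i) + b (cyc n i) = c (cyc n i) + d (cyc n i)"
    and mult: "\<And>i. a (cyc n i) * b (cyc n (i + 1)) = c (cyc n i) * d (cyc n (i + 1))"
  shows "mat_mult (whirl n a) (whirl n b) = mat_mult (whirl n c) (whirl n d)"
proof (intro ext)
  fix i j
  show "mat_mult (whirl n a) (whirl n b) i j = mat_mult (whirl n c) (whirl n d) i j"
    unfolding mat_mult_whirl_right[OF whirl_unitriangular]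
    using sum[of i] mult[of i] by (auto simp: whirl_def add.commute)
qed

lemma curl_mult_whirl_neg: "mat_mult (curl n p) (whirl n (\<lambda>i. - p i)) = mat_one"
proof (intro ext)
  fix i j :: int
  have "{i..<j} = insert (j - 1) {i..<j - 1}" if "i < j" using that by auto
  then show "mat_mult (curl n p) (whirl n (\<lambda>i. - p i)) i j = mat_one i j"
    unfolding mat_mult_whirl_right[OF curl_unitriangular]
    by (auto simp: curl_def mat_one_def)
qed

lemma whirl_neg_mult_curl: "mat_mult (whirl n (\<lambda>i. - p i)) (curl n p) = mat_one"
proof (intro ext)
  fix i j :: int
  have "{i..<j} = insert i {i + 1..<j}" if "i < j" using that by auto
  then show "mat_mult (whirl n (\<lambda>i. - p i)) (curl n p) i j = mat_one i j"
    unfolding mat_mult_whirl_left[OF curl_unitriangular]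
    by (auto simp: curl_def mat_one_def)
qed

text \<open>The curl of \<open>p\<close> is the two-sided inverse of the whirl of \<open>- p\<close>, and inversion reverses the order of the factors.\<close>

lemma curl_mult_eqI:
  assumes "mat_mult (whirl n (\<lambda>i. - b i)) (whirl n (\<lambda>i. - a i))
         = mat_mult (whirl n (\<lambda>i. - d i)) (whirl n (\<lambda>i. - c i))"
  shows "mat_mult (curl n a) (curl n b) = mat_mult (curl n c) (curl n d)"
proof -
  let ?M = "\<lambda>p. whirl n (\<lambda>i. - p i)" and ?N = "curl n"
  note u = curl_unitriangular whirl_unitriangular unitriangular_mat_mult
  have "mat_mult (?N c) (?N d)
      = mat_mult (mat_mult (?N c) (?N d)) (mat_mult (?M b) (mat_mult (mat_mult (?M a) (?N a)) (?N b)))"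
    by (simp add: whirl_neg_mult_curl mat_mult_one_left mat_mult_one_right u)
  also have "\<dots> = mat_mult (mat_mult (?N c) (?N d)) (mat_mult (mat_mult (?M b) (?M a)) (mat_mult (?N a) (?N b)))"
    by (simp add: mat_mult_assoc u)
  also have "\<dots> = mat_mult (?N c) (mat_mult (mat_mult (?N d) (?M d)) (mat_mult (?M c) (mat_mult (?N a) (?N b))))"
    by (simp add: assms mat_mult_assoc u)
  also have "\<dots> = mat_mult (?N c) (mat_mult (?M c) (mat_mult (?N a) (?N b)))"
    by (simp add: curl_mult_whirl_neg mat_mult_one_left u)
  also have "\<dots> = mat_mult (mat_mult (?N c) (?M c)) (mat_mult (?N a) (?N b))"
    by (simp only: mat_mult_assoc u)
  also have "\<dots> = mat_mult (?N a) (?N b)"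
    by (simp add: curl_mult_whirl_neg mat_mult_one_left u)
  finally show ?thesis by simp
qed

lemma kappa_tendsto:
  assumes "\<And>i. (\<lambda>m. p m i) \<longlonglongrightarrow> a i" "\<And>i. (\<lambda>m. q m i) \<longlonglongrightarrow> b i"
  shows "(\<lambda>m. kappa n (p m) (q m) i) \<longlonglongrightarrow> kappa n a b i"
  unfolding kappa_def by (intro tendsto_intros assms)

lemma kappa_le:
  assumes "1 \<le> n" "positive_param n a" "positive_param n b" "\<And>i. a i \<le> D" "\<And>i. b i \<le> D"
  shows "kappa n a b i \<le> real n * D ^ (n - 1)"
proof -
  have nonneg: "0 \<le> a i" "0 \<le> b i" for i
    using assms(2,3) by (auto intro: less_imp_le positive_paramD(2))
  have "(\<Prod>k<r. b (i + 1 + int k)) * (\<Prod>k=Suc r..<n. a (i + int k)) \<le> D ^ (n - 1)" if "r < n" for r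
  proof -
    have "(\<Prod>k<r. b (i + 1 + int k)) * (\<Prod>k=Suc r..<n. a (i + int k)) \<le> (\<Prod>k<r. D) * (\<Prod>k=Suc r..<n. D)"
      using nonneg assms(4,5) order_trans[OF nonneg(1) assms(4)]
      by (intro mult_mono prod_mono prod_nonneg) auto
    also have "\<dots> = D ^ (n - 1)" using that by (simp flip: power_add)
    finally show ?thesis .
  qed
  then have "kappa n a b i \<le> (\<Sum>r<n. D ^ (n - 1))"
    unfolding kappa_def by (intro sum_mono) auto
  then show ?thesis by simp
qed

text \<open>The two extreme summands. Whichever argument is the one bounded away from zero, \<open>kappa\<close> is bounded below by it alone, even when the other argument is tiny.\<close>

lemma kappa_ge:
  assumes "1 \<le> n" "positive_param n a" "positive_param n b"
  shows "(\<Prod>k<n - 1. b (i + 1 + int k)) \<le> kappa n a b i"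
    and "(\<Prod>k=1..<n. a (i + int k)) \<le> kappa n a b i"
proof -
  let ?F = "\<lambda>r. (\<Prod>k<r. b (i + 1 + int k)) * (\<Prod>k=Suc r..<n. a (i + int k))"
  have F: "?F r \<le> kappa n a b i" if "r < n" for r
    unfolding kappa_def using that assms(2,3)
    by (intro member_le_sum mult_nonneg_nonneg prod_nonneg) (auto intro: less_imp_le positive_paramD(2))
  show "(\<Prod>k<n - 1. b (i + 1 + int k)) \<le> kappa n a b i"
    using F[of "n - 1"] assms(1) by simp
  show "(\<Prod>k=1..<n. a (i + int k)) \<le> kappa n a b i"
    using F[of 0] assms(1) by simp
qed

lemma kappa_ratio_le:
  assumes "1 \<le> n" "positive_param n a" "positive_param n b" "\<And>i. a i \<le> D" "\<And>i. b i \<le> D"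
    and "0 < d" "d ^ (n - 1) \<le> kappa n a b i" "0 < x" "x \<le> s"
  shows "x * kappa n a b j / kappa n a b i \<le> real n * (D / d) ^ (n - 1) * s"
proof -
  have "0 \<le> D" using order_trans[OF less_imp_le[OF positive_paramD(2)[OF assms(2)]] assms(4)] .
  have "kappa n a b j / kappa n a b i \<le> real n * D ^ (n - 1) / d ^ (n - 1)"
    using kappa_le[OF assms(1-5)] kappa_pos[OF assms(1-3)] assms(6,7) \<open>0 \<le> D\<close>
    by (intro frac_le) auto
  also have "\<dots> = real n * (D / d) ^ (n - 1)" by (simp add: power_divide)
  finally have "kappa n a b j / kappa n a b i * x \<le> real n * (D / d) ^ (n - 1) * s"
    using assms(6,8,9) \<open>0 \<le> D\<close> by (intro mult_mono) auto
  then show ?thesis by (simp add: mult.commute)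
qed

lemma factor_family_whirl:
  assumes n: "1 \<le> n"
  shows "factor_family n (whirl n) (whirlL n) (whirlR n)"
proof
  show "1 \<le> n" by (rule n)
  show "unitriangular (whirl n p)" for p by (rule whirl_unitriangular)
  show "whirl n p i (i + 1) = p i" if "positive_param n p" for p i
    using positive_paramD(3)[OF that] by (simp add: whirl_def)
  show "dominated s (whirl n p)" if p: "positive_param n p" and "\<And>i. p i \<le> s" for p s
  proof -
    have "0 \<le> s" using that(2)[of 0] positive_paramD(2)[OF p, of 0] by linarith
    then show ?thesis
      using that(2) positive_paramD(2,3)[OF p] by (auto simp: dominated_def whirl_def less_imp_le)
  qed
  show "mat_lim (\<lambda>m. whirl n (q m)) (whirl n p)" if "\<And>i. (\<lambda>m. q m i) \<longlonglongrightarrow> p i" for q p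
    using that by (auto simp: mat_lim_def whirl_def)
  show "whirl n (\<lambda>i. p (cyc n i)) = whirl n p" for p
    by (simp add: whirl_def fun_eq_iff)
  show "mat_reverse (whirl n p) = whirl n (\<lambda>i. p (- 1 - i))" if p: "positive_param n p" for p
  proof (intro ext)
    fix i j :: int
    have "p (- i - 1) = p (- 1 - i)" by (rule arg_cong[of _ _ p]) simp
    then show "mat_reverse (whirl n p) i j = whirl n (\<lambda>i. p (- 1 - i)) i j"
      using positive_paramD(3)[OF p] positive_paramD(3)[OF positive_param_reverse[OF p]]
      by (auto simp: mat_reverse_def whirl_def)
  qed
  fix a b assume a: "positive_param n a" and b: "positive_param n b"
  show "positive_param n (whirlL n a b) \<and> positive_param n (whirlR n a b)"
    using whirl_push_param[OF n a b] by simp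
  show "mat_mult (whirl n a) (whirl n b) = mat_mult (whirl n (whirlL n a b)) (whirl n (whirlR n a b))"
    using positive_paramD(3)[OF a] positive_paramD(3)[OF b]
      positive_paramD(3)[OF whirl_push_param(1)[OF n a b]] positive_paramD(3)[OF whirl_push_param(2)[OF n a b]]
    by (intro whirl_mult_eqI) (simp_all add: whirl_push_sum[OF n a b] whirl_push_mult[OF n a b])
  show "(\<lambda>m. whirlL n a (q m) i) \<longlonglongrightarrow> whirlL n a b i" if "\<And>i. (\<lambda>m. q m i) \<longlonglongrightarrow> b i" for q i
    unfolding whirlL_def using kappa_pos[OF n a b, of i]
    by (intro tendsto_intros kappa_tendsto that) auto
  show "whirlR n a b i \<le> real n * (D / d) ^ (n - 1) * s"
    if "0 < d" "\<And>i. d \<le> b i" "\<And>i. b i \<le> D" "\<And>i. a i \<le> D" "\<And>i. a i \<le> s" for d D s i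
  proof -
    have "(\<Prod>k<n - 1. d) \<le> (\<Prod>k<n - 1. b (i + 1 + int k))"
      using that(1,2) by (intro prod_mono) auto
    then have "d ^ (n - 1) \<le> kappa n a b i"
      using kappa_ge(1)[OF n a b, of i] by simp
    then show ?thesis
      unfolding whirlR_def using that positive_paramD(2)[OF a] by (intro kappa_ratio_le n a b) auto
  qed
qed

text \<open>Inversion turns the exchange of \<open>a\<close> and \<open>b\<close> for curls into that of \<open>- b\<close> and \<open>- a\<close> for whirls. The exchange equations are homogeneous, so the signs drop out, and the whirl maps apply with their arguments and their roles interchanged.\<close>

lemma factor_family_curl:
  assumes n: "1 \<le> n"
  shows "factor_family n (curl n) (\<lambda>a b. whirlR n b a) (\<lambda>a b. whirlL n b a)"
proof
  show "1 \<le> n" by (rule n)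
  show "unitriangular (curl n p)" for p by (rule curl_unitriangular)
  show "curl n p i (i + 1) = p i" if "positive_param n p" for p i
  proof -
    have "{i..<i + 1} = {i}" by auto
    then show ?thesis using positive_paramD(3)[OF that] by (simp add: curl_def)
  qed
  show "dominated s (curl n p)" if p: "positive_param n p" and "\<And>i. p i \<le> s" for p s
  proof -
    have pos: "0 < p (cyc n k)" for k by (rule positive_paramD(2)[OF p])
    have "(\<Prod>k\<in>{i..<j}. p (cyc n k)) \<le> s ^ nat (j - i)" for i j
    proof -
      have "(\<Prod>k\<in>{i..<j}. p (cyc n k)) \<le> (\<Prod>k\<in>{i..<j}. s)"
        using pos that(2) by (intro prod_mono) (auto intro: less_imp_le)
      then show ?thesis by simp
    qed
    then show ?thesis
      using pos by (auto simp: dominated_def curl_def intro!: less_imp_le[OF prod_pos])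
  qed
  show "mat_lim (\<lambda>m. curl n (q m)) (curl n p)" if "\<And>i. (\<lambda>m. q m i) \<longlonglongrightarrow> p i" for q p
    using that by (auto simp: mat_lim_def curl_def intro!: tendsto_prod)
  show "curl n (\<lambda>i. p (cyc n i)) = curl n p" for p
    by (simp add: curl_def fun_eq_iff)
  show "mat_reverse (curl n p) = curl n (\<lambda>i. p (- 1 - i))" if p: "positive_param n p" for p
  proof (intro ext)
    fix i j :: int
    have "(\<Prod>k\<in>{- j..<- i}. p k) = (\<Prod>k\<in>{i..<j}. p (- 1 - k))"
      by (rule prod.reindex_bij_witness[of _ "\<lambda>k. - 1 - k" "\<lambda>k. - 1 - k"]) auto
    then show "mat_reverse (curl n p) i j = curl n (\<lambda>i. p (- 1 - i)) i j"
      using positive_paramD(3)[OF p] positive_paramD(3)[OF positive_param_reverse[OF p]]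
      by (auto simp: mat_reverse_def curl_def)
  qed
  fix a b assume a: "positive_param n a" and b: "positive_param n b"
  show "positive_param n (whirlR n b a) \<and> positive_param n (whirlL n b a)"
    using whirl_push_param[OF n b a] by simp
  show "mat_mult (curl n a) (curl n b) = mat_mult (curl n (whirlR n b a)) (curl n (whirlL n b a))"
    using positive_paramD(3)[OF a] positive_paramD(3)[OF b] whirl_push_sum[OF n b a]
      positive_paramD(3)[OF whirl_push_param(1)[OF n b a]] positive_paramD(3)[OF whirl_push_param(2)[OF n b a]]
    by (intro curl_mult_eqI whirl_mult_eqI) (simp_all add: whirl_push_mult[OF n b a] algebra_simps)
  show "(\<lambda>m. whirlR n (q m) a i) \<longlonglongrightarrow> whirlR n b a i" if "\<And>i. (\<lambda>m. q m i) \<longlonglongrightarrow> b i" for q i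
    unfolding whirlR_def using kappa_pos[OF n b a, of i]
    by (intro tendsto_intros kappa_tendsto that) auto
  show "whirlL n b a i \<le> real n * (D / d) ^ (n - 1) * s"
    if "0 < d" "\<And>i. d \<le> b i" "\<And>i. b i \<le> D" "\<And>i. a i \<le> D" "\<And>i. a i \<le> s" for d D s i
  proof -
    have "(\<Prod>k=1..<n. d) \<le> (\<Prod>k=1..<n. b (i + int k))"
      using that(1,2) by (intro prod_mono) auto
    then have "d ^ (n - 1) \<le> kappa n b a i"
      using kappa_ge(2)[OF n b a, of i] by simp
    then show ?thesis
      unfolding whirlL_def using that positive_paramD(2)[OF a] by (intro kappa_ratio_le n a b) auto
  qed
qed

section \<open>The four semigroups\<close>

lemma admissible_range_iff:
  fixes g :: "nat \<Rightarrow> int" and a :: "int \<Rightarrow> int \<Rightarrow> real"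
  assumes "inj g" and "\<And>i j. i \<in> range g \<Longrightarrow> j \<in> {1..int n} \<Longrightarrow> 0 \<le> a i j"
  shows "(\<lambda>(i, j). a i j) summable_on (range g \<times> {1..int n})
     \<longleftrightarrow> (\<forall>j\<in>{1..int n}. summable (\<lambda>k. a (g k) j))"
proof -
  have col: "(\<lambda>i. norm (a i j)) summable_on range g \<longleftrightarrow> summable (\<lambda>k. a (g k) j)"
    if "j \<in> {1..int n}" for j
    unfolding summable_on_iff_abs_summable_on_real[symmetric] summable_on_reindex[OF assms(1)]
    using assms(2) that by (subst summable_on_UNIV_nonneg_real_iff) (auto simp: o_def)
  have "(\<lambda>(i, j). a i j) summable_on (range g \<times> {1..int n})
     \<longleftrightarrow> (\<lambda>p. norm (case p of (j, i) \<Rightarrow> a i j)) summable_on ({1..int n} \<times> range g)"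
    unfolding summable_on_iff_abs_summable_on_real[symmetric]
    by (subst summable_on_swap) simp
  also have "\<dots> \<longleftrightarrow> (\<forall>j\<in>{1..int n}. (\<lambda>i. norm (a i j)) summable_on range g)"
    unfolding Infinite_Sum.abs_summable_on_Sigma_iff by simp
  finally show ?thesis using col by simp
qed

lemma tendsto_int_at_top_iff:
  "((f :: int \<Rightarrow> real) \<longlongrightarrow> L) at_top \<longleftrightarrow> (\<lambda>m. f (int m)) \<longlonglongrightarrow> L"
  using filterlim_compose[OF _ filterlim_int_sequentially] filterlim_int_of_nat_at_topD by blast

lemma tendsto_int_at_bot_iff:
  "((f :: int \<Rightarrow> real) \<longlongrightarrow> L) at_bot \<longleftrightarrow> (\<lambda>m. f (- int m)) \<longlonglongrightarrow> L"
proof -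
  have "filterlim uminus at_top (at_bot :: int filter)" "filterlim uminus at_bot (at_top :: int filter)"
    unfolding filterlim_at_top filterlim_at_bot eventually_at_top_linorder eventually_at_bot_linorder
    by (meson minus_le_iff le_minus_iff)+
  then have "(f \<longlongrightarrow> L) at_bot \<longleftrightarrow> ((\<lambda>k. f (- k)) \<longlongrightarrow> L) at_top"
    using filterlim_compose[of f "nhds L" at_bot uminus at_top]
      filterlim_compose[of "\<lambda>k. f (- k)" "nhds L" at_top uminus at_bot] by auto
  then show ?thesis by (simp add: tendsto_int_at_top_iff)
qed

lemma mat_prod_right: "mat_prod X 1 (int m) = prod_mats (map (\<lambda>k. X (1 + int k)) [0..<m])"
proof -
  have "map X [1..int m] = map (\<lambda>k. X (1 + int k)) [0..<m]"
    by (induction m) (simp_all add: upto_rec2)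
  then show ?thesis by (simp add: mat_prod_def prod_mats_def)
qed

lemma mat_prod_left: "mat_prod X (- int m) (- 1) = prod_mats (rev (map (\<lambda>k. X (- 1 - int k)) [0..<m]))"
proof -
  have "map X [- int m..- 1] = rev (map (\<lambda>k. X (- 1 - int k)) [0..<m])"
  proof (induction m)
    case (Suc m)
    have "[- int (Suc m)..- 1] = - int (Suc m) # [- int m..- 1]"
      by (subst upto_rec1) auto
    then show ?case using Suc by simp
  qed simp
  then show ?thesis by (simp add: mat_prod_def prod_mats_def)
qed

context factor_family
begin

lemma valid_seq_if_admissible:
  assumes "inj g" "admissible n (range g) a"
  shows "valid_seq (\<lambda>k i. a (g k) (cyc n i))"
proof -
  have pos: "0 < a (g k) (cyc n i)" for k i
    using assms(2) cyc_range[OF n_pos, of i] by (auto simp: admissible_def nondegenerate_def)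
  have "summable (\<lambda>k. a (g k) j)" if "j \<in> {1..int n}" for j
  proof -
    have "0 \<le> a i j" if "i \<in> range g" "j \<in> {1..int n}" for i j
      using assms(2) that by (auto simp: admissible_def nondegenerate_def intro: less_imp_le)
    then show ?thesis
      using admissible_range_iff[OF assms(1), of n a] assms(2) that by (simp add: admissible_def)
  qed
  then show ?thesis
    using pos cyc_range[OF n_pos] by (simp add: valid_seq_def positive_param_def cyc_periodic)
qed

lemma admissible_if_valid_seq:
  assumes "inj g" "valid_seq A"
  shows "admissible n (range g) (\<lambda>i. A (inv g i))"
  using assms admissible_range_iff[of g n "\<lambda>i. A (inv g i)"] valid_seq_param[OF assms(2)]
  by (auto simp: admissible_def nondegenerate_def valid_seq_def intro: less_imp_le positive_paramD(2))

text \<open>The passage from integer index sets to sequences over the naturals, for a property \<open>\<Phi>\<close> of the sequence of factors. A parameter tuple enters its factor only through \<open>cyc n\<close>, so it can be replaced by its periodic extension.\<close>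

lemma valid_seq_iff_admissible:
  assumes "inj g"
  shows "(\<exists>A. valid_seq A \<and> \<Phi> (\<lambda>k. E (A k))) \<longleftrightarrow> (\<exists>a. admissible n (range g) a \<and> \<Phi> (\<lambda>k. E (a (g k))))"
proof
  assume "\<exists>A. valid_seq A \<and> \<Phi> (\<lambda>k. E (A k))"
  then obtain A where "valid_seq A" "\<Phi> (\<lambda>k. E (A k))" by blast
  then show "\<exists>a. admissible n (range g) a \<and> \<Phi> (\<lambda>k. E (a (g k)))"
    using admissible_if_valid_seq[OF assms] assms by (intro exI[of _ "\<lambda>i. A (inv g i)"]) simp
next
  assume "\<exists>a. admissible n (range g) a \<and> \<Phi> (\<lambda>k. E (a (g k)))"
  then obtain a where "admissible n (range g) a" "\<Phi> (\<lambda>k. E (a (g k)))" by blast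
  then show "\<exists>A. valid_seq A \<and> \<Phi> (\<lambda>k. E (A k))"
    using valid_seq_if_admissible[OF assms]
    by (intro exI[of _ "\<lambda>k i. a (g k) (cyc n i)"]) (simp add: E_cyc)
qed

lemma right_products_eq:
  "right_products = {P. \<exists>a. admissible n {1..} a \<and> is_right_inf_prod (\<lambda>i. E (a i)) P}"
proof -
  have inj: "inj (\<lambda>k. 1 + int k)" by (simp add: inj_def)
  have "range (\<lambda>k. 1 + int k) = {1..}"
    by (auto simp: image_iff) (metis add.commute diff_add_cancel diff_ge_0_iff_ge nonneg_int_cases)
  then show ?thesis
    using valid_seq_iff_admissible[OF inj, of "\<lambda>X. mat_lim (\<lambda>m. prod_mats (map X [0..<m])) _"]
    by (simp add: right_products_def partial_prod_def[abs_def] is_right_inf_prod_def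
        entrywise_limit_def tendsto_int_at_top_iff mat_prod_right mat_lim_def)
qed

lemma left_products_eq:
  "left_products = {P. \<exists>a. admissible n {..-1} a \<and> is_left_inf_prod (\<lambda>i. E (a i)) P}"
proof -
  have inj: "inj (\<lambda>k. - 1 - int k)" by (simp add: inj_def)
  have "range (\<lambda>k. - 1 - int k) = {..-1}"
  proof
    show "{..-1} \<subseteq> range (\<lambda>k. - 1 - int k)"
    proof
      fix i :: int assume "i \<in> {..-1}"
      then have "i = - 1 - int (nat (- 1 - i))" by simp
      then show "i \<in> range (\<lambda>k. - 1 - int k)" by blast
    qed
  qed auto
  then show ?thesis
    using valid_seq_iff_admissible[OF inj, of "\<lambda>X. mat_lim (\<lambda>m. prod_mats (rev (map X [0..<m]))) _"]
    by (simp add: left_products_def is_left_inf_prod_def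
        entrywise_limit_def tendsto_int_at_bot_iff mat_prod_left mat_lim_def)
qed

end

theorem theorem9p1:
  fixes n :: nat
  assumes "n \<ge> 1"
  shows "semigroup_on (RC n) mat_mult
    \<and> semigroup_on (LC n) mat_mult
    \<and> semigroup_on (RW n) mat_mult
    \<and> semigroup_on (LW n) mat_mult"
proof -
  interpret W: factor_family n "whirl n" "whirlL n" "whirlR n"
    by (rule factor_family_whirl[OF assms])
  interpret C: factor_family n "curl n" "\<lambda>a b. whirlR n b a" "\<lambda>a b. whirlL n b a"
    by (rule factor_family_curl[OF assms])
  show ?thesis
    using C.semigroup_right_products C.semigroup_left_products
      W.semigroup_right_products W.semigroup_left_products
    unfolding C.right_products_eq C.left_products_eq W.right_products_eq W.left_products_eq
      RC_def LC_def RW_def LW_def by blast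
qed

end
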